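(* Let $\alpha\in\mathbb{R}$ with $\alpha/(2\pi)\notin\mathbb{Q}$, let $\lambda\in\mathbb{R}\setminus\{0\}$, and consider the potential $\lambda\mathrm{e}^{\mathrm{i}x}$. Then the Lyapunov exponent satisfies $$L(E)=\max\{0,\log|\lambda|\}\qquad\text{for all }E\in\Sigma_{\lambda\exp,\alpha}.$$ Moreover, $$L(E)=\max\Big\{\log\Big|\frac{E}{2}+\frac{\sqrt{E^2-4}}{2}\Big|,\ \log|\lambda|\Big\}\qquad\text{for all }E\in\mathbb{C}.$$
   Context: $\mathbb{T}=\mathbb{R}/2\pi\mathbb{Z}$. $\Sigma_{\lambda\exp,\alpha}$ is the spectrum (independent of $x\in\mathbb{T}$) of the operator on $\ell^2(\mathbb{Z})$ given by $(H\psi)_n=\psi_{n+1}+\psi_{n-1}+\lambda\mathrm{e}^{\mathrm{i}(x+n\alpha)}\psi_n$. For $E\in\mathbb{C}$ let $S_E(x)=\begin{pmatrix}E-\lambda\mathrm{e}^{\mathrm{i}x}&-1\\1&0\end{pmatrix}$ and $S_n(x)=S_E(x+(n-1)\alpha)\cdots S_E(x)$ for $n\ge1$. The Lyapunov exponent is $L(E)=\lim_{n\to\infty}\frac1n\int_{\mathbb{T}}\log\|S_n(x)\|\,\mathrm{d}x$, where $\mathrm{d}x$ is normalized Lebesgue (probability) measure. The branch of $\sqrt{E^2-4}$ is chosen so that $\big|\frac E2+\frac{\sqrt{E^2-4}}2\big|\ge1$. *)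

theory Defs
  imports "HOL-Analysis.Analysis"
begin

section \<open>Bounded operators on two-sided square-summable sequences\<close>

definition l2 :: "(int \<Rightarrow> complex) set" where
  "l2 = {\<psi>. (\<lambda>n. (cmod (\<psi> n))\<^sup>2) summable_on UNIV}"

definition l2_norm :: "(int \<Rightarrow> complex) \<Rightarrow> real" where
  "l2_norm \<psi> = sqrt (\<Sum>\<^sub>\<infinity>n\<in>UNIV. (cmod (\<psi> n))\<^sup>2)"

text \<open>Operators are total functions on all sequences; only their values on \<open>l2\<close> matter.\<close>

definition l2_bounded_linear :: "((int \<Rightarrow> complex) \<Rightarrow> (int \<Rightarrow> complex)) \<Rightarrow> bool" where
  "l2_bounded_linear A \<longleftrightarrow>
     (\<forall>\<psi>\<in>l2. A \<psi> \<in> l2) \<and>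
     (\<forall>\<psi>\<in>l2. \<forall>\<phi>\<in>l2. A (\<lambda>n. \<psi> n + \<phi> n) = (\<lambda>n. A \<psi> n + A \<phi> n)) \<and>
     (\<forall>c. \<forall>\<psi>\<in>l2. A (\<lambda>n. c * \<psi> n) = (\<lambda>n. c * A \<psi> n)) \<and>
     (\<exists>C. \<forall>\<psi>\<in>l2. l2_norm (A \<psi>) \<le> C * l2_norm \<psi>)"

text \<open>The spectrum of a bounded operator \<open>A\<close>: all \<open>E\<close> such that \<open>A - E\<close> has no bounded
  two-sided inverse on \<open>l2\<close>.\<close>

definition l2_spectrum :: "((int \<Rightarrow> complex) \<Rightarrow> (int \<Rightarrow> complex)) \<Rightarrow> complex set" where
  "l2_spectrum A =
     {E. \<not> (\<exists>R. l2_bounded_linear R \<and>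
            (\<forall>\<psi>\<in>l2. R (\<lambda>n. A \<psi> n - E * \<psi> n) = \<psi>) \<and>
            (\<forall>\<psi>\<in>l2. (\<lambda>n. A (R \<psi>) n - E * R \<psi> n) = \<psi>))}"


section \<open>The operator with potential \<open>\<lambda> exp (i x)\<close>\<close>

definition exp_operator ::
    "real \<Rightarrow> real \<Rightarrow> real \<Rightarrow> (int \<Rightarrow> complex) \<Rightarrow> (int \<Rightarrow> complex)" where
  "exp_operator lam \<alpha> x \<psi> =
     (\<lambda>n. \<psi> (n + 1) + \<psi> (n - 1) + of_real lam * cis (x + of_int n * \<alpha>) * \<psi> n)"


section \<open>Transfer matrices and the Lyapunov exponent\<close>

definition step_matrix :: "real \<Rightarrow> complex \<Rightarrow> real \<Rightarrow> complex^2^2" where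
  "step_matrix lam E x =
     vector [vector [E - of_real lam * cis x, -1],
             vector [1, 0]]"

primrec transfer_matrix :: "real \<Rightarrow> real \<Rightarrow> complex \<Rightarrow> nat \<Rightarrow> real \<Rightarrow> complex^2^2" where
  "transfer_matrix lam \<alpha> E 0 x = mat 1"
| "transfer_matrix lam \<alpha> E (Suc n) x =
     step_matrix lam E (x + of_nat n * \<alpha>) ** transfer_matrix lam \<alpha> E n x"

text \<open>The matrix norm is the operator norm for the Euclidean norm on \<open>complex^2\<close>; the mean over
  the circle is the Lebesgue integral over one period divided by \<open>2 * pi\<close>.\<close>

definition lyapunov_mean :: "real \<Rightarrow> real \<Rightarrow> complex \<Rightarrow> nat \<Rightarrow> real" where
  "lyapunov_mean lam \<alpha> E n =
     1 / of_nat n * ((LINT x:{0..<2*pi}|lborel.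
        ln (onorm (\<lambda>v. transfer_matrix lam \<alpha> E n x *v v))) / (2 * pi))"

definition lyapunov_exponent :: "real \<Rightarrow> real \<Rightarrow> complex \<Rightarrow> real" where
  "lyapunov_exponent lam \<alpha> E = lim (lyapunov_mean lam \<alpha> E)"

end

theory Submission
  imports Defs "HOL-Complex_Analysis.Cauchy_Integral_Formula"
begin

text \<open>Write \<open>E = w + 1/w\<close> with \<open>\<bar>w\<bar> \<ge> 1\<close>, \<open>q = exp (i \<alpha>)\<close> and \<open>z = exp (i x)\<close>. The entries of
  \<open>S\<^sub>n(x)\<close> are polynomials in \<open>z\<close> whose coefficients are explicit sums of products of two Gaussian
  binomial coefficients at \<open>q\<close>, of size at most \<open>\<bar>w\<bar>\<^sup>n\<^sup>-\<^sup>k \<bar>\<lambda>\<bar>\<^sup>k\<close> up to those binomials. By the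
  \<open>q\<close>-binomial theorem the latter are bounded by the maximum over \<open>\<bar>t\<bar> = 1\<close> of the product of
  \<open>\<bar>1 + q\<^sup>j t\<bar>\<close>, which grows subexponentially since the irrational rotation is uniquely ergodic and
  \<open>ln \<bar>1 + t\<bar>\<close> has mean zero. This gives the upper bound for \<open>L(E)\<close>, uniformly in \<open>x\<close>. The lower
  bound is Jensen's inequality applied at \<open>z = 0\<close> and at \<open>z = \<infinity>\<close>.

  For the spectrum it remains to see that \<open>\<bar>w\<bar> > max 1 \<bar>\<lambda>\<bar>\<close> implies that \<open>E\<close> lies in the resolvent
  set. Expanding \<open>(E - H)\<^sup>-\<^sup>1\<close> in powers of the potential, the \<open>k\<close>-th term is a twisted convolution
  operator whose kernel is again a product of two sequences of Gaussian binomial coefficients, so the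
  same subexponential bound makes the series converge.\<close>

section \<open>Gaussian binomial coefficients on the unit circle\<close>

text \<open>Given by the q-Pascal recursion instead of a quotient of products of
  \<open>1 - q ^ j\<close>, so that it makes sense in every commutative ring and at roots of
  unity.\<close>

fun qbinom :: "'a::comm_ring_1 \<Rightarrow> nat \<Rightarrow> nat \<Rightarrow> 'a" where
  "qbinom q n 0 = 1"
| "qbinom q 0 (Suc k) = 0"
| "qbinom q (Suc n) (Suc k) = qbinom q n k + q ^ Suc k * qbinom q n (Suc k)"

lemma qbinom_eq_0: "n < k \<Longrightarrow> qbinom q n k = 0"
  by (induction q n k rule: qbinom.induct) auto

lemma qbinom_self [simp]: "qbinom q n n = 1"
  by (induction n) (simp_all add: qbinom_eq_0)

lemma cnj_qbinom: "cnj (qbinom q n k) = qbinom (cnj q) n k"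
  by (induction q n k rule: qbinom.induct) auto

lemma choose_two_Suc: "Suc k choose 2 = k + (k choose 2)"
  by (simp add: numeral_2_eq_2)

text \<open>Induction on \<open>n\<close> with \<open>t\<close> arbitrary: removing the factor
  \<open>j = 0\<close> leaves the shorter product at \<open>q * t\<close>, and multiplying its
  expansion by \<open>1 + t\<close> joins adjacent coefficients as in the q-Pascal
  recursion.\<close>

lemma qbinomial_theorem:
  "(\<Prod>j<n. 1 + q ^ j * t) = (\<Sum>k\<le>n. q ^ (k choose 2) * qbinom q n k * t ^ k)"
proof (induction n arbitrary: t)
  case 0
  show ?case by (simp add: binomial_eq_0)
next
  case (Suc n)
  define a where "a = (\<lambda>k. q ^ (k choose 2) * qbinom q n k * (q * t) ^ k)"
  have pascal: "q ^ (Suc k choose 2) * qbinom q (Suc n) (Suc k) * t ^ Suc k = a (Suc k) + t * a k" for k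
    by (simp add: a_def choose_two_Suc power_add power_mult_distrib algebra_simps)
  have a_top: "a (Suc n) = 0"
    by (simp add: a_def qbinom_eq_0)
  have "(\<Prod>j<Suc n. 1 + q ^ j * t) = (1 + t) * (\<Prod>j<n. 1 + q ^ j * (q * t))"
    unfolding prod.lessThan_Suc_shift by (simp add: ac_simps)
  also have "\<dots> = (1 + t) * (\<Sum>k\<le>n. a k)"
    by (simp only: Suc.IH a_def)
  also have "\<dots> = (\<Sum>k\<le>Suc n. a k) + t * (\<Sum>k\<le>n. a k)"
    by (simp add: a_top algebra_simps)
  also have "\<dots> = a 0 + (\<Sum>k\<le>n. a (Suc k) + t * a k)"
    by (simp only: sum.atMost_Suc_shift sum.distrib sum_distrib_left) simp
  also have "\<dots> = a 0 + (\<Sum>k\<le>n. q ^ (Suc k choose 2) * qbinom q (Suc n) (Suc k) * t ^ Suc k)"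
    by (simp only: pascal)
  also have "\<dots> = (\<Sum>k\<le>Suc n. q ^ (k choose 2) * qbinom q (Suc n) k * t ^ k)"
    unfolding sum.atMost_Suc_shift[of _ n] by (simp add: a_def)
  finally show ?case .
qed

section \<open>From values on the unit circle to coefficients\<close>

lemma higher_deriv_poly: "(deriv ^^ n) (poly p) = poly ((pderiv ^^ n) p)"
  for p :: "complex poly"
proof (induction n)
  case (Suc n)
  have "deriv (poly r) = poly (pderiv r)" for r :: "complex poly"
    by (rule ext, rule DERIV_imp_deriv, rule poly_DERIV)
  then show ?case using Suc by simp
qed simp

text \<open>Cauchy's estimate on the unit disc: the \<open>k\<close>-th derivative at 0 is
  \<open>fact k * coeff p k\<close>.\<close>

lemma norm_coeff_le_circle:
  fixes p :: "complex poly"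
  assumes "\<And>z. cmod z = 1 \<Longrightarrow> cmod (poly p z) \<le> B"
  shows "cmod (coeff p k) \<le> B"
proof -
  have "norm ((deriv ^^ k) (poly p) 0) \<le> fact k * B / 1 ^ k"
    by (rule Cauchy_inequality) (auto intro!: holomorphic_intros continuous_intros assms)
  moreover have "(deriv ^^ k) (poly p) 0 = fact k * coeff p k"
    by (simp add: higher_deriv_poly poly_0_coeff_0 coeff_higher_pderiv pochhammer_fact)
  ultimately show ?thesis
    by (simp add: norm_mult)
qed

text \<open>By the q-binomial theorem \<open>qbinom q n k\<close> is, up to a factor of modulus one,
  a coefficient of the product as a polynomial in \<open>t\<close>.\<close>

lemma norm_qbinom_le_circle:
  fixes q :: complex
  assumes "cmod q = 1" and B: "\<And>t. cmod t = 1 \<Longrightarrow> cmod (\<Prod>j<n. 1 + q ^ j * t) \<le> B"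
  shows "cmod (qbinom q n k) \<le> B"
proof (cases "k \<le> n")
  case True
  define p where "p = (\<Sum>k\<le>n. monom (q ^ (k choose 2) * qbinom q n k) k)"
  have "poly p t = (\<Prod>j<n. 1 + q ^ j * t)" for t
    by (simp add: p_def poly_sum poly_monom qbinomial_theorem)
  then have "cmod (coeff p k) \<le> B"
    by (intro norm_coeff_le_circle) (simp add: B)
  moreover have "coeff p k = q ^ (k choose 2) * qbinom q n k"
    using True by (simp add: p_def coeff_sum coeff_monom)
  ultimately show ?thesis
    using assms(1) by (simp add: norm_mult norm_power)
next
  case False
  moreover have "0 \<le> B"
    by (rule order_trans[OF norm_ge_zero B[of 1]]) simp
  ultimately show ?thesis
    by (simp add: qbinom_eq_0)
qed

text \<open>With \<open>c = Re t\<close> the squares of the two sides differ by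
  \<open>2 * (1 - r)\<^sup>2 * (1 - c)\<close>. This moves the point off the singularity of the
  logarithm at \<open>t = -1\<close> at the price of a factor \<open>2 / (1 + r)\<close>.\<close>

lemma norm_one_plus_le_contract:
  assumes "cmod t = 1" "0 \<le> r" "r \<le> 1"
  shows "(1 + r) * cmod (1 + t) \<le> 2 * cmod (1 + of_real r * t)"
proof (rule power2_le_imp_le)
  define c where "c = Re t"
  have t: "(Re t)\<^sup>2 + (Im t)\<^sup>2 = 1"
    using assms(1) by (simp add: cmod_def)
  have c: "c \<le> 1"
    using complex_Re_le_cmod[of t] assms(1) by (simp add: c_def)
  have "(cmod (1 + of_real s * t))\<^sup>2 = 1 + s\<^sup>2 + 2 * s * c" for s
    using t unfolding c_def cmod_power2 by (simp add: power2_eq_square) algebra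
  from this[of 1] this[of r]
  have "(2 * cmod (1 + of_real r * t))\<^sup>2 - ((1 + r) * cmod (1 + t))\<^sup>2
      = 4 * (1 + r\<^sup>2 + 2 * r * c) - (1 + r)\<^sup>2 * (2 + 2 * c)"
    by (simp add: power_mult_distrib)
  also have "\<dots> = 2 * (1 - r)\<^sup>2 * (1 - c)"
    by (simp add: power2_eq_square algebra_simps)
  also have "\<dots> \<ge> 0"
    using c by simp
  finally show "((1 + r) * cmod (1 + t))\<^sup>2 \<le> (2 * cmod (1 + of_real r * t))\<^sup>2"
    by simp
qed (use assms in auto)

lemma norm_geometric_sum_le:
  fixes z :: complex
  assumes "cmod z = 1" "z \<noteq> 1"
  shows "cmod (\<Sum>j<n. z ^ j) \<le> 2 / cmod (1 - z)"
proof -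
  have "cmod (1 - z ^ n) \<le> 2"
    using norm_triangle_ineq4[of 1 "z ^ n"] assms(1) by (simp add: norm_power)
  then show ?thesis
    using assms(2) by (simp add: sum_gp_strict norm_divide divide_right_mono)
qed

text \<open>The logarithm of the product is an orbit sum of \<open>ln \<bar>1 + t\<bar>\<close>, which has mean zero;
  damping \<open>t\<close> to \<open>r t\<close> makes its Fourier series absolutely convergent.\<close>

lemma prod_one_plus_rotation_le:
  fixes q :: complex
  assumes q: "cmod q = 1" "\<And>m. 0 < m \<Longrightarrow> q ^ m \<noteq> 1" and "\<epsilon> > 0"
  obtains C where "C > 0"
    "\<And>n t. cmod t = 1 \<Longrightarrow> cmod (\<Prod>j<n. 1 + q ^ j * t) \<le> C * exp (\<epsilon> * n)"
proof -
  \<comment> \<open>Half of \<epsilon> pays for the damping factor \<open>2 / (1 + r)\<close>, the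
    other half for the tail of the series beyond \<open>M\<close>. The bound \<open>1 / 2\<close>
    keeps \<open>r\<close> positive.\<close>
  define \<delta> where "\<delta> = min (1 / 2) (\<epsilon> / 2)"
  define r where "r = 1 - \<delta>"
  have \<delta>: "0 < \<delta>" "\<delta> \<le> 1 / 2" "\<delta> \<le> \<epsilon> / 2"
    using \<open>\<epsilon> > 0\<close> by (auto simp: \<delta>_def)
  then have r: "0 < r" "r < 1"
    by (auto simp: r_def)
  have "\<delta> * \<epsilon> \<le> (1 / 2) * \<epsilon>"
    by (intro mult_right_mono) (use \<delta> \<open>\<epsilon> > 0\<close> in auto)
  moreover have "(1 + r) * (1 + \<epsilon> / 2) = 2 + \<epsilon> - \<delta> - \<delta> * \<epsilon> / 2"
    by (simp add: r_def field_simps)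
  ultimately have "2 \<le> (1 + r) * (1 + \<epsilon> / 2)"
    using \<delta> by linarith
  also have "\<dots> \<le> (1 + r) * exp (\<epsilon> / 2)"
    using r by (intro mult_left_mono) auto
  finally have damp: "2 / (1 + r) \<le> exp (\<epsilon> / 2)"
    using r by (simp add: field_simps)
  have "summable (\<lambda>m. r ^ m)"
    using r by (simp add: summable_geometric)
  then obtain M where M: "norm (\<Sum>i. r ^ (i + M)) < \<epsilon> / 2"
    using suminf_exist_split[of "\<epsilon> / 2" "\<lambda>m. r ^ m"] \<open>\<epsilon> > 0\<close> by auto
  \<comment> \<open>Bounds the orbit sums of the finitely many frequencies below \<open>M\<close>,
    independently of \<open>n\<close> and \<open>t\<close>.\<close>
  define K where "K = (\<Sum>m\<in>{1..<M}. 2 / cmod (1 - q ^ m))"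
  \<comment> \<open>Terms of the series of \<open>Ln (1 + r * t)\<close>. Division by zero makes the
    term \<open>m = 0\<close> vanish, in accordance with mean zero.\<close>
  define a where "a = (\<lambda>t m. - ((- (of_real r * t)) ^ m) / of_nat m :: complex)"
  have a_norm: "cmod (a t m) \<le> r ^ m" if "cmod t = 1" for t m
  proof (cases "m = 0")
    case False
    have "r ^ m / real m \<le> r ^ m / 1"
      using r False by (intro divide_left_mono) auto
    then show ?thesis
      using that r by (simp add: a_def norm_divide norm_power norm_mult)
  qed (simp add: a_def)
  have Ln_eq: "Re (Ln (1 + of_real r * t)) \<le> (\<Sum>m<M. Re (a t m)) + \<epsilon> / 2" if t: "cmod t = 1" for t
  proof -
    have sums: "a t sums Ln (1 + of_real r * t)"
      unfolding a_def using r t Ln_series'[of "of_real r * t"] by (simp add: norm_mult)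
    have sum1: "summable (\<lambda>i. r ^ (i + M))"
      using \<open>summable (\<lambda>m. r ^ m)\<close> by (subst summable_iff_shift)
    have "Ln (1 + of_real r * t) = (\<Sum>i. a t (i + M)) + (\<Sum>m<M. a t m)"
      using sums suminf_split_initial_segment[of "a t" M] by (simp add: sums_iff)
    moreover have "cmod (\<Sum>i. a t (i + M)) \<le> (\<Sum>i. r ^ (i + M))"
      by (rule norm_suminf_le) (use a_norm[OF t] sum1 in auto)
    then have "Re (\<Sum>i. a t (i + M)) \<le> \<epsilon> / 2"
      using M complex_Re_le_cmod[of "\<Sum>i. a t (i + M)"] by simp
    ultimately show ?thesis
      by simp
  qed
  show ?thesis
  proof (rule that[of "exp K"])
    show "exp K > 0" by simp
    fix n :: nat and t :: complex
    assume t: "cmod t = 1"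
    have qt: "cmod (q ^ j * t) = 1" for j
      using q(1) t by (simp add: norm_mult norm_power)
    \<comment> \<open>Along the rotation the term of frequency \<open>m\<close> picks up powers of
      \<open>q ^ m\<close>, so its orbit sum is a geometric sum.\<close>
    have a_rot: "a (q ^ j * t) m = a t m * (q ^ m) ^ j" for j m
    proof -
      have "- (of_real r * (q ^ j * t)) = - (of_real r * t) * q ^ j"
        by (simp only: minus_mult_left mult_ac)
      then have "(- (of_real r * (q ^ j * t))) ^ m = (- (of_real r * t)) ^ m * (q ^ m) ^ j"
        by (simp only: power_mult_distrib power_mult [symmetric] mult.commute[of j m])
      then show ?thesis
        by (simp add: a_def)
    qed
    have fac: "cmod (1 + q ^ j * t) \<le> exp (\<epsilon> / 2 + Re (Ln (1 + of_real r * (q ^ j * t))))" for j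
    proof -
      have "cmod (of_real r * (q ^ j * t)) < 1"
        using r qt[of j] by (simp add: norm_mult)
      then have nz: "1 + of_real r * (q ^ j * t) \<noteq> 0"
        by (metis add_eq_0_iff norm_minus_cancel norm_one less_irrefl)
      have "cmod (1 + q ^ j * t) \<le> 2 / (1 + r) * cmod (1 + of_real r * (q ^ j * t))"
        using norm_one_plus_le_contract[OF qt[of j], of r] r by (simp add: field_simps)
      also have "\<dots> \<le> exp (\<epsilon> / 2) * cmod (1 + of_real r * (q ^ j * t))"
        using damp by (intro mult_right_mono) auto
      also have "\<dots> = exp (\<epsilon> / 2 + Re (Ln (1 + of_real r * (q ^ j * t))))"
        using nz by (simp add: exp_add)
      finally show ?thesis .
    qed
    have "(\<Sum>j<n. \<Sum>m<M. Re (a (q ^ j * t) m)) = (\<Sum>m<M. Re (\<Sum>j<n. a (q ^ j * t) m))"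
      by (subst sum.swap) simp
    also have "\<dots> = (\<Sum>m<M. Re (a t m * (\<Sum>j<n. (q ^ m) ^ j)))"
      by (simp only: a_rot sum_distrib_left)
    also have "\<dots> \<le> (\<Sum>m<M. if m = 0 then 0 else 2 / cmod (1 - q ^ m))"
    proof (rule sum_mono)
      fix m
      show "Re (a t m * (\<Sum>j<n. (q ^ m) ^ j)) \<le> (if m = 0 then 0 else 2 / cmod (1 - q ^ m))"
      proof (cases "m = 0")
        case False
        have "Re (a t m * (\<Sum>j<n. (q ^ m) ^ j)) \<le> cmod (a t m) * cmod (\<Sum>j<n. (q ^ m) ^ j)"
          using complex_Re_le_cmod by (metis norm_mult)
        also have "\<dots> \<le> 1 * (2 / cmod (1 - q ^ m))"
        proof (intro mult_mono)
          show "cmod (a t m) \<le> 1"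
            using a_norm[OF t, of m] power_le_one[of r m] r by linarith
          show "cmod (\<Sum>j<n. (q ^ m) ^ j) \<le> 2 / cmod (1 - q ^ m)"
            using q False by (intro norm_geometric_sum_le) (auto simp: norm_power)
        qed auto
        finally show ?thesis using False by simp
      qed (simp add: a_def)
    qed
    also have "\<dots> = K"
      unfolding K_def by (rule sum.mono_neutral_cong_right) auto
    finally have K: "(\<Sum>j<n. \<Sum>m<M. Re (a (q ^ j * t) m)) \<le> K" .
    have "cmod (\<Prod>j<n. 1 + q ^ j * t) \<le> (\<Prod>j<n. exp (\<epsilon> / 2 + Re (Ln (1 + of_real r * (q ^ j * t)))))"
      unfolding prod_norm [symmetric] by (intro prod_mono) (use fac in auto)
    also have "\<dots> = exp (\<Sum>j<n. \<epsilon> / 2 + Re (Ln (1 + of_real r * (q ^ j * t))))"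
      by (simp only: exp_sum finite_lessThan)
    also have "\<dots> \<le> exp (\<Sum>j<n. \<epsilon> + (\<Sum>m<M. Re (a (q ^ j * t) m)))"
      by (subst exp_le_cancel_iff, rule sum_mono) (use Ln_eq[OF qt] in \<open>smt (verit) field_sum_of_halves\<close>)
    also have "\<dots> \<le> exp (K + \<epsilon> * n)"
      using K by (simp add: sum.distrib mult.commute)
    finally show "cmod (\<Prod>j<n. 1 + q ^ j * t) \<le> exp K * exp (\<epsilon> * n)"
      by (simp add: exp_add)
  qed
qed

lemma norm_qbinom_subexponential:
  fixes q :: complex
  assumes "cmod q = 1" "\<And>m. 0 < m \<Longrightarrow> q ^ m \<noteq> 1" "\<epsilon> > 0"
  obtains C where "C > 0" "\<And>n k. cmod (qbinom q n k) \<le> C * exp (\<epsilon> * n)"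
proof (rule prod_one_plus_rotation_le[OF assms])
  fix C :: real
  assume C: "C > 0"
    "\<And>n t. cmod t = 1 \<Longrightarrow> cmod (\<Prod>j<n. 1 + q ^ j * t) \<le> C * exp (\<epsilon> * n)"
  show thesis
    by (rule that[OF C(1)], rule norm_qbinom_le_circle) (use assms(1) C(2) in auto)
qed

lemma cis_power_neq_1:
  assumes "\<alpha> / (2 * pi) \<notin> \<rat>" "0 < m"
  shows "cis \<alpha> ^ m \<noteq> 1"
proof
  assume "cis \<alpha> ^ m = 1"
  then have "exp (\<i> * of_real (real m * \<alpha>)) = 1"
    unfolding Complex.DeMoivre by (simp add: cis_conv_exp)
  then obtain k :: int where k: "real m * \<alpha> = of_int (2 * k) * pi"
    by (auto simp: exp_eq_1)
  have "\<alpha> / (2 * pi) = of_int k / of_nat m"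
    using k \<open>0 < m\<close> by (simp add: field_simps)
  then show False
    using assms(1) by (simp add: Rats_divide)
qed

section \<open>Expansion of the transfer matrices\<close>

unbundle no vec_syntax
unbundle fps_syntax

text \<open>Determinant of \<open>E - H\<close> on \<open>n\<close> consecutive sites, the potential at the \<open>j\<close>-th one
  being \<open>q\<^sup>j \<mu>\<close>.\<close>

fun hill_det :: "complex \<Rightarrow> complex \<Rightarrow> complex \<Rightarrow> nat \<Rightarrow> complex" where
  "hill_det q E \<mu> 0 = 1"
| "hill_det q E \<mu> (Suc 0) = E - \<mu>"
| "hill_det q E \<mu> (Suc (Suc n)) =
     (E - q ^ Suc n * \<mu>) * hill_det q E \<mu> (Suc n) - hill_det q E \<mu> n"

text \<open>Power series of the product over \<open>j \<le> k\<close> of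
  \<open>1 / (1 - q ^ j * c * X)\<close>.\<close>

definition qbinom_fps :: "complex \<Rightarrow> nat \<Rightarrow> complex \<Rightarrow> complex fps" where
  "qbinom_fps q k c = Abs_fps (\<lambda>m. c ^ m * qbinom q (k + m) m)"

lemma qbinom_fps_0: "(1 - fps_const c * fps_X) * qbinom_fps q 0 c = 1"
proof (rule fps_ext)
  fix n
  show "((1 - fps_const c * fps_X) * qbinom_fps q 0 c) $ n = 1 $ n"
    by (cases n) (simp_all add: qbinom_fps_def left_diff_distrib mult.assoc)
qed

text \<open>Cancelling the factor \<open>j = 0\<close> leaves the factors of index \<open>k\<close>
  at \<open>q * c\<close>; coefficientwise this is the q-Pascal recursion.\<close>

lemma qbinom_fps_Suc:
  "(1 - fps_const c * fps_X) * qbinom_fps q (Suc k) c = qbinom_fps q k (q * c)"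
proof (rule fps_ext)
  fix n
  show "((1 - fps_const c * fps_X) * qbinom_fps q (Suc k) c) $ n = qbinom_fps q k (q * c) $ n"
    by (cases n)
      (simp_all add: qbinom_fps_def left_diff_distrib mult.assoc power_mult_distrib algebra_simps)
qed

text \<open>Coefficient \<open>m\<close> of \<open>qbinom_fps\<close> is homogeneous of degree
  \<open>m\<close> in its argument, so scaling both arguments by \<open>q\<close> substitutes
  \<open>q * X\<close> for \<open>X\<close>. This produces the dilated series in the functional
  equation.\<close>

lemma qbinom_fps_dilate:
  "(qbinom_fps q k (q * a) * qbinom_fps q k (q * b)) $ n
    = q ^ n * (qbinom_fps q k a * qbinom_fps q k b) $ n"
  unfolding fps_mult_nth sum_distrib_left
proof (intro sum.cong refl)
  fix i assume "i \<in> {0..n}"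
  then have "q ^ n = q ^ i * q ^ (n - i)"
    by (simp flip: power_add)
  then show "qbinom_fps q k (q * a) $ i * qbinom_fps q k (q * b) $ (n - i)
      = q ^ n * (qbinom_fps q k a $ i * qbinom_fps q k b $ (n - i))"
    by (simp add: qbinom_fps_def power_mult_distrib)
qed

text \<open>Writing \<open>E = w + 1/w\<close>, the generating function \<open>G(t)\<close> of the determinants satisfies
  \<open>(1 - E t + t\<^sup>2) G(t) = 1 - \<mu> t G(q t)\<close>; iterating gives the coefficient of \<open>\<mu>\<^sup>k\<close>.\<close>

definition hill_coeff :: "complex \<Rightarrow> complex \<Rightarrow> nat \<Rightarrow> nat \<Rightarrow> complex" where
  "hill_coeff q w k n = (fps_X ^ k * (qbinom_fps q k w * qbinom_fps q k (inverse w))) $ n"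

lemma hill_coeff_eq_0: "n < k \<Longrightarrow> hill_coeff q w k n = 0"
  by (simp add: hill_coeff_def fps_X_power_mult_nth)

lemma quadratic_fps:
  fixes w :: complex
  assumes "w \<noteq> 0"
  shows "1 - fps_const (w + inverse w) * fps_X + fps_X ^ 2
    = (1 - fps_const w * fps_X) * (1 - fps_const (inverse w) * fps_X)"
proof -
  have "fps_const w * fps_const (inverse w) = 1"
    using assms by simp
  moreover have "fps_const (w + inverse w) = fps_const w + fps_const (inverse w)"
    by simp
  ultimately show ?thesis
    by algebra
qed

lemma quadratic_fps_mult_nth:
  fixes c :: complex
  shows "((1 - fps_const c * fps_X + fps_X ^ 2) * G) $ Suc (Suc n)
    = G $ Suc (Suc n) - c * G $ Suc n + G $ n"
  by (simp add: distrib_right left_diff_distrib mult.assoc fps_X_power_mult_nth)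

lemma hill_coeff_0_rec:
  assumes "w \<noteq> 0"
  shows "hill_coeff q w 0 (Suc (Suc n))
    = (w + inverse w) * hill_coeff q w 0 (Suc n) - hill_coeff q w 0 n"
proof -
  define F where "F = qbinom_fps q 0 w * qbinom_fps q 0 (inverse w)"
  have "(1 - fps_const (w + inverse w) * fps_X + fps_X ^ 2) * F
    = ((1 - fps_const w * fps_X) * qbinom_fps q 0 w)
      * ((1 - fps_const (inverse w) * fps_X) * qbinom_fps q 0 (inverse w))"
    unfolding quadratic_fps[OF assms] F_def by (simp only: mult_ac)
  also have "\<dots> = 1"
    by (simp only: qbinom_fps_0 mult_1)
  finally have "((1 - fps_const (w + inverse w) * fps_X + fps_X ^ 2) * F) $ Suc (Suc n) = 0"
    by simp
  then show ?thesis
    unfolding quadratic_fps_mult_nth by (simp add: hill_coeff_def F_def [symmetric])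
      (simp add: algebra_simps)
qed

text \<open>The quadratic cancels the factor \<open>j = 0\<close> in both products and leaves the
  dilated series of index \<open>k\<close>. The dilation does not act on \<open>X ^ k\<close>, hence
  the exponent \<open>Suc n - k\<close>; where this subtraction truncates, the coefficient is
  zero.\<close>

lemma hill_coeff_Suc_rec:
  assumes "w \<noteq> 0"
  shows "hill_coeff q w (Suc k) (Suc (Suc n))
    = (w + inverse w) * hill_coeff q w (Suc k) (Suc n) - hill_coeff q w (Suc k) n
      + q ^ (Suc n - k) * hill_coeff q w k (Suc n)"
proof -
  define F where "F = (\<lambda>k. qbinom_fps q k w * qbinom_fps q k (inverse w))"
  define D where "D = qbinom_fps q k (q * w) * qbinom_fps q k (q * inverse w)"
  have "(1 - fps_const (w + inverse w) * fps_X + fps_X ^ 2) * F (Suc k)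
    = ((1 - fps_const w * fps_X) * qbinom_fps q (Suc k) w)
      * ((1 - fps_const (inverse w) * fps_X) * qbinom_fps q (Suc k) (inverse w))"
    unfolding quadratic_fps[OF assms] F_def by (simp only: mult_ac)
  also have "\<dots> = D"
    by (simp only: qbinom_fps_Suc D_def)
  finally have "(1 - fps_const (w + inverse w) * fps_X + fps_X ^ 2) * (fps_X ^ Suc k * F (Suc k))
    = fps_X * (fps_X ^ k * D)"
    by (metis mult.assoc mult.left_commute power_Suc)
  then have "((1 - fps_const (w + inverse w) * fps_X + fps_X ^ 2) * (fps_X ^ Suc k * F (Suc k)))
      $ Suc (Suc n) = (fps_X ^ k * D) $ Suc n"
    by (simp only: fps_X_mult_nth) simp
  moreover have "(fps_X ^ k * D) $ Suc n = q ^ (Suc n - k) * hill_coeff q w k (Suc n)"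
    by (simp add: D_def hill_coeff_def fps_X_power_mult_nth qbinom_fps_dilate)
  ultimately show ?thesis
    unfolding quadratic_fps_mult_nth hill_coeff_def F_def by (simp add: diff_eq_eq) (simp add: algebra_simps)
qed

text \<open>Both sides obey the same recursion in \<open>n\<close>. At order \<open>Suc k\<close>
  the site factor \<open>q ^ Suc n\<close> splits into \<open>q ^ k\<close>, which turns
  \<open>k choose 2\<close> into \<open>Suc k choose 2\<close>, and the
  \<open>q ^ (Suc n - k)\<close> of \<open>hill_coeff_Suc_rec\<close>.\<close>

lemma hill_det_expansion:
  assumes "w \<noteq> 0"
  shows "hill_det q (w + inverse w) \<mu> n
    = (\<Sum>k\<le>n. (- \<mu>) ^ k * q ^ (k choose 2) * hill_coeff q w k n)"
proof -
  define T where "T = (\<lambda>k n. (- \<mu>) ^ k * q ^ (k choose 2) * hill_coeff q w k n)"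
  define E where "E = w + inverse w"
  have T_0: "T k n = 0" if "n < k" for k n
    using that by (simp add: T_def hill_coeff_eq_0)
  \<comment> \<open>Since terms with \<open>k > n\<close> vanish, the sums for consecutive
    \<open>n\<close> can be taken over a common range.\<close>
  have ext: "(\<Sum>k\<le>n. T k n) = (\<Sum>k\<le>m. T k n)" if "n \<le> m" for n m
    by (rule sum.mono_neutral_left) (use that T_0 in auto)
  have shift: "(\<Sum>k\<le>m. T k m) = T 0 m + (\<Sum>k\<le>Suc n. T (Suc k) m)" if "m \<le> Suc n" for m n
    using ext[of m "Suc (Suc n)"] that unfolding sum.atMost_Suc_shift[of _ "Suc n"] by linarith
  have rec0: "T 0 (Suc (Suc n)) = E * T 0 (Suc n) - T 0 n" for n
    by (simp add: T_def E_def hill_coeff_0_rec[OF assms] binomial_eq_0)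
  have rec: "T (Suc k) (Suc (Suc n)) = E * T (Suc k) (Suc n) - T (Suc k) n
      - q ^ Suc n * \<mu> * T k (Suc n)" for k n
  proof (cases "k \<le> Suc n")
    case True
    then have "q ^ Suc n = q ^ k * q ^ (Suc n - k)"
      by (simp flip: power_add)
    then show ?thesis
      by (simp only: T_def E_def hill_coeff_Suc_rec[OF assms] choose_two_Suc power_add power_Suc)
        (simp add: algebra_simps)
  qed (simp add: T_0)
  have "hill_det q E \<mu> n = (\<Sum>k\<le>n. T k n)"
  proof (induction n rule: induct_nat_012)
    case 0
    show ?case
      by (simp add: T_def hill_coeff_def binomial_eq_0 qbinom_fps_def)
  next
    case 1
    have "hill_coeff q w 0 1 = E"
      by (simp add: hill_coeff_def fps_mult_nth qbinom_fps_def E_def)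
    then show ?case
      by (simp add: T_def hill_coeff_def fps_X_power_mult_nth binomial_eq_0 qbinom_fps_def)
  next
    case (ge2 n)
    have "(\<Sum>k\<le>Suc (Suc n). T k (Suc (Suc n)))
      = T 0 (Suc (Suc n)) + (\<Sum>k\<le>Suc n. T (Suc k) (Suc (Suc n)))"
      by (rule sum.atMost_Suc_shift)
    also have "\<dots> = E * (T 0 (Suc n) + (\<Sum>k\<le>Suc n. T (Suc k) (Suc n)))
        - (T 0 n + (\<Sum>k\<le>Suc n. T (Suc k) n)) - q ^ Suc n * \<mu> * (\<Sum>k\<le>Suc n. T k (Suc n))"
      unfolding rec0 rec by (simp add: sum.distrib sum_subtractf sum_distrib_left algebra_simps)
    also have "\<dots> = E * (\<Sum>k\<le>Suc n. T k (Suc n)) - (\<Sum>k\<le>n. T k n)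
        - q ^ Suc n * \<mu> * (\<Sum>k\<le>Suc n. T k (Suc n))"
      by (simp only: shift[of n n] shift[of "Suc n" n] le_SucI order_refl)
    finally show ?case
      by (simp add: ge2 algebra_simps)
  qed
  then show ?thesis
    by (simp add: E_def T_def)
qed

text \<open>The Cauchy product has \<open>n - k + 1\<close> terms. In each, the binomial bounds
  multiply to \<open>C\<^sup>2 * exp (\<epsilon> * (n + k))\<close>, and the powers of
  \<open>w\<close> to at most \<open>cmod w ^ (n - k)\<close> because the negative ones are bounded
  by 1.\<close>

lemma norm_hill_coeff_le:
  assumes w: "cmod w \<ge> 1" and C: "C > 0" "\<epsilon> > 0"
    and B: "\<And>n k. cmod (qbinom q n k) \<le> C * exp (\<epsilon> * n)" and "k \<le> n"
  shows "cmod (hill_coeff q w k n) \<le> real (Suc n) * C\<^sup>2 * exp (2 * \<epsilon> * n) * cmod w ^ (n - k)"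
proof -
  have coeff: "cmod (qbinom_fps q k c $ m) \<le> cmod c ^ m * (C * exp (\<epsilon> * (k + m)))" for c m
    using B[of "k + m" m] by (simp add: qbinom_fps_def norm_mult norm_power mult_left_mono)
  have hc: "hill_coeff q w k n = (qbinom_fps q k w * qbinom_fps q k (inverse w)) $ (n - k)"
    using \<open>k \<le> n\<close> by (simp add: hill_coeff_def fps_X_power_mult_nth)
  have "cmod (hill_coeff q w k n)
      \<le> (\<Sum>i=0..n - k. cmod (qbinom_fps q k w $ i * qbinom_fps q k (inverse w) $ (n - k - i)))"
    unfolding hc fps_mult_nth by (rule norm_sum)
  also have "\<dots> \<le> (\<Sum>i=0..n - k. C\<^sup>2 * exp (2 * \<epsilon> * n) * cmod w ^ (n - k))"
  proof (rule sum_mono)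
    fix i assume i: "i \<in> {0..n - k}"
    have "cmod (inverse w) ^ (n - k - i) \<le> 1"
      using w by (intro power_le_one) (auto simp: norm_inverse inverse_le_1_iff)
    moreover have "cmod w ^ i \<le> cmod w ^ (n - k)"
      using w i by (intro power_increasing) auto
    ultimately have ww: "cmod w ^ i * cmod (inverse w) ^ (n - k - i) \<le> cmod w ^ (n - k)"
      using mult_mono[of "cmod w ^ i" "cmod w ^ (n - k)" "cmod (inverse w) ^ (n - k - i)" 1] by simp
    have "cmod (qbinom_fps q k w $ i * qbinom_fps q k (inverse w) $ (n - k - i))
      \<le> (cmod w ^ i * (C * exp (\<epsilon> * (k + i))))
        * (cmod (inverse w) ^ (n - k - i) * (C * exp (\<epsilon> * (k + (n - k - i)))))"
      unfolding norm_mult by (intro mult_mono coeff) (use C in auto)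
    also have "\<dots> = (cmod w ^ i * cmod (inverse w) ^ (n - k - i))
        * (C\<^sup>2 * (exp (\<epsilon> * (k + i)) * exp (\<epsilon> * (k + (n - k - i)))))"
      by (simp add: power2_eq_square mult_ac)
    also have "exp (\<epsilon> * (k + i)) * exp (\<epsilon> * (k + (n - k - i))) = exp (\<epsilon> * (n + k))"
      using i \<open>k \<le> n\<close> by (simp add: of_nat_diff algebra_simps flip: exp_add)
    also have "(cmod w ^ i * cmod (inverse w) ^ (n - k - i)) * (C\<^sup>2 * exp (\<epsilon> * (n + k)))
      \<le> cmod w ^ (n - k) * (C\<^sup>2 * exp (2 * \<epsilon> * n))"
      using ww C \<open>k \<le> n\<close> by (intro mult_mono mult_left_mono) auto
    finally show "cmod (qbinom_fps q k w $ i * qbinom_fps q k (inverse w) $ (n - k - i))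
      \<le> C\<^sup>2 * exp (2 * \<epsilon> * n) * cmod w ^ (n - k)"
      by (simp add: mult_ac)
  qed
  also have "\<dots> = real (Suc (n - k)) * (C\<^sup>2 * exp (2 * \<epsilon> * n) * cmod w ^ (n - k))"
    by simp
  also have "\<dots> \<le> real (Suc n) * (C\<^sup>2 * exp (2 * \<epsilon> * n) * cmod w ^ (n - k))"
    by (intro mult_right_mono) auto
  finally show ?thesis
    by (simp add: mult_ac)
qed

lemma norm_hill_det_le:
  assumes q: "cmod q = 1" and w: "cmod w \<ge> 1" and C: "C > 0" "\<epsilon> > 0"
    and B: "\<And>n k. cmod (qbinom q n k) \<le> C * exp (\<epsilon> * n)"
  shows "cmod (hill_det q (w + inverse w) \<mu> n)
    \<le> (real (Suc n))\<^sup>2 * C\<^sup>2 * exp (2 * \<epsilon> * n) * max (cmod w) (cmod \<mu>) ^ n"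
proof -
  define M where "M = max (cmod w) (cmod \<mu>)"
  have "w \<noteq> 0"
    using w by auto
  have "cmod (hill_det q (w + inverse w) \<mu> n)
      \<le> (\<Sum>k\<le>n. cmod \<mu> ^ k * cmod (hill_coeff q w k n))"
    unfolding hill_det_expansion[OF \<open>w \<noteq> 0\<close>]
    by (rule order_trans[OF norm_sum]) (simp add: norm_mult norm_power q)
  also have "\<dots> \<le> (\<Sum>k\<le>n. real (Suc n) * C\<^sup>2 * exp (2 * \<epsilon> * n) * M ^ n)"
  proof (rule sum_mono)
    fix k assume k: "k \<in> {..n}"
    have "cmod \<mu> ^ k * cmod (hill_coeff q w k n)
      \<le> M ^ k * (real (Suc n) * C\<^sup>2 * exp (2 * \<epsilon> * n) * M ^ (n - k))"
    proof (intro mult_mono power_mono)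
      have "cmod (hill_coeff q w k n) \<le> real (Suc n) * C\<^sup>2 * exp (2 * \<epsilon> * n) * cmod w ^ (n - k)"
        using k by (intro norm_hill_coeff_le w C B) auto
      also have "\<dots> \<le> real (Suc n) * C\<^sup>2 * exp (2 * \<epsilon> * n) * M ^ (n - k)"
        by (intro mult_left_mono power_mono) (auto simp: M_def)
      finally show "cmod (hill_coeff q w k n) \<le> real (Suc n) * C\<^sup>2 * exp (2 * \<epsilon> * n) * M ^ (n - k)" .
    qed (auto simp: M_def le_max_iff_disj)
    also have "\<dots> = real (Suc n) * C\<^sup>2 * exp (2 * \<epsilon> * n) * (M ^ k * M ^ (n - k))"
      by (simp only: mult_ac)
    also have "M ^ k * M ^ (n - k) = M ^ n"
      using k by (simp flip: power_add)
    finally show "cmod \<mu> ^ k * cmod (hill_coeff q w k n)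
      \<le> real (Suc n) * C\<^sup>2 * exp (2 * \<epsilon> * n) * M ^ n" .
  qed
  also have "\<dots> = (real (Suc n))\<^sup>2 * C\<^sup>2 * exp (2 * \<epsilon> * n) * M ^ n"
    by (simp add: power2_eq_square mult_ac)
  finally show ?thesis
    by (simp only: M_def)
qed

unbundle no fps_syntax
unbundle vec_syntax

section \<open>Jensen's inequality for polynomials on the circle\<close>

text \<open>Each cell of length \<open>c\<close> contains its node \<open>y + c * r\<close>, so
  replacing the integrand by the value there costs at most \<epsilon>. The offset \<open>y\<close>
  is arbitrary because the maximum principle will dictate it.\<close>

lemma integral_ge_shifted_riemann_sum:
  fixes u :: "real \<Rightarrow> real"
  assumes cont: "continuous_on {0..L} u" and "M > 0" and c: "c = L / real M" and "L > 0"
    and y: "y \<in> {0..c}"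
    and osc: "\<And>s t. s \<in> {0..L} \<Longrightarrow> t \<in> {0..L} \<Longrightarrow> \<bar>s - t\<bar> \<le> c \<Longrightarrow> \<bar>u s - u t\<bar> \<le> \<epsilon>"
  shows "integral {0..L} u \<ge> c * (\<Sum>r<M. u (y + c * real r)) - L * \<epsilon>"
proof -
  have c0: "c > 0" and cM: "c * M = L"
    using assms by auto
  have "integral {0..c * k} u \<ge> (\<Sum>r<k. c * (u (y + c * real r) - \<epsilon>))" if "k \<le> M" for k
    using that
  proof (induction k)
    case (Suc k)
    have le: "c * Suc k \<le> L"
      using Suc.prems c0 unfolding cM [symmetric] by (intro mult_left_mono) auto
    have int: "u integrable_on {a..b}" if "0 \<le> a" "b \<le> L" for a b
      by (rule integrable_continuous_real, rule continuous_on_subset[OF cont]) (use that in auto)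
    have step: "c * Suc k = c * k + c" "0 \<le> c * k"
      using c0 by (auto simp: algebra_simps)
    have "c * (u (y + c * k) - \<epsilon>) = integral {c * k..c * Suc k} (\<lambda>_. u (y + c * k) - \<epsilon>)"
      using c0 by (simp add: algebra_simps)
    also have "\<dots> \<le> integral {c * k..c * Suc k} u"
    proof (rule integral_le)
      fix s assume s: "s \<in> {c * k..c * Suc k}"
      have bounds: "c * k \<le> s" "s \<le> c * k + c" "0 \<le> y" "y \<le> c" "c * k + c \<le> L"
        using s y le step(1) by auto
      have "\<bar>u (y + c * k) - u s\<bar> \<le> \<epsilon>"
      proof (rule osc)
        show "y + c * k \<in> {0..L}" "s \<in> {0..L}" "\<bar>y + c * k - s\<bar> \<le> c"
          using bounds step(2) unfolding atLeastAtMost_iff by linarith+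
      qed
      then show "u (y + c * k) - \<epsilon> \<le> u s"
        by linarith
    qed (use int le step in auto)
    finally have "c * (u (y + c * k) - \<epsilon>) \<le> integral {c * k..c * Suc k} u" .
    moreover have "integral {0..c * k} u + integral {c * k..c * Suc k} u = integral {0..c * Suc k} u"
      by (rule Henstock_Kurzweil_Integration.integral_combine) (use step le int c0 in auto)
    ultimately show ?case
      using Suc by simp
  qed simp
  from this[of M] have "integral {0..L} u \<ge> (\<Sum>r<M. c * (u (y + c * real r) - \<epsilon>))"
    by (simp add: cM)
  also have "(\<Sum>r<M. c * (u (y + c * real r) - \<epsilon>)) = c * (\<Sum>r<M. u (y + c * real r)) - L * \<epsilon>"
    by (simp add: sum_subtractf right_diff_distrib sum_distrib_left cM[symmetric])
  finally show ?thesis .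
qed

text \<open>The maximum principle applied to \<open>\<Prod>r<M. p (cis (2 \<pi> r / M) z)\<close>, which is invariant
  under rotation by \<open>2 \<pi> / M\<close>.\<close>

lemma exists_prod_rotations_ge:
  fixes p :: "complex poly"
  assumes "M > 0" and c: "c = 2 * pi / real M"
  obtains y where "y \<in> {0..c}" "cmod (coeff p 0) ^ M \<le> (\<Prod>r<M. cmod (poly p (cis (y + c * real r))))"
proof -
  define F where "F = (\<Prod>r<M. p \<circ>\<^sub>p [:0, cis (c * real r):])"
  have F: "poly F z = (\<Prod>r<M. poly p (z * cis (c * real r)))" for z
    by (simp add: F_def poly_prod poly_pcompose)
  have c0: "c > 0" and cM: "c * M = 2 * pi"
    using assms by auto
  obtain M' where M': "M = Suc M'"
    using \<open>M > 0\<close> gr0_conv_Suc by blast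
  have rot: "poly F (z * cis c) = poly F z" for z
  proof -
    have "poly F (z * cis c) = (\<Prod>r<M. poly p (z * cis (c * Suc r)))"
      unfolding F by (simp add: cis_mult algebra_simps)
    also have "\<dots> = (\<Prod>r<M'. poly p (z * cis (c * Suc r))) * poly p (z * cis (c * M))"
      by (simp add: M')
    also have "\<dots> = poly p (z * cis (c * real 0)) * (\<Prod>r<M'. poly p (z * cis (c * Suc r)))"
      by (subst mult.commute) (simp add: cM)
    also have "\<dots> = poly F z"
      unfolding F M' prod.lessThan_Suc_shift by simp
    finally show ?thesis .
  qed
  have rots: "poly F (z * cis (c * real k)) = poly F z" for z k
  proof (induction k)
    case (Suc k)
    have "z * cis (c * real (Suc k)) = z * cis (c * real k) * cis c"
      by (simp add: cis_mult algebra_simps)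
    then show ?case
      by (simp only: rot Suc)
  qed simp
  \<comment> \<open>By the rotation invariance \<open>rots\<close>, the maximum over one arc of
    length \<open>c\<close> is the maximum over the circle; this places \<open>y\<close> in the
    first cell.\<close>
  have "\<exists>y\<in>{0..c}. \<forall>s\<in>{0..c}. cmod (poly F (cis s)) \<le> cmod (poly F (cis y))"
    using c0 by (intro continuous_attains_sup continuous_intros) auto
  then obtain y where y: "y \<in> {0..c}"
      "\<And>s. s \<in> {0..c} \<Longrightarrow> cmod (poly F (cis s)) \<le> cmod (poly F (cis y))"
    by blast
  have "cmod (poly F z) \<le> cmod (poly F (cis y))" if z: "cmod z = 1" for z
  proof -
    define \<theta> where "\<theta> = Arg2pi z"
    define k where "k = nat \<lfloor>\<theta> / c\<rfloor>"
    have "z = cis \<theta>" "0 \<le> \<theta>"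
      using z Arg2pi_eq[of z] Arg2pi_ge_0[of z] by (auto simp: \<theta>_def cis_conv_exp)
    have k: "real k \<le> \<theta> / c" "\<theta> / c < real k + 1"
      using \<open>0 \<le> \<theta>\<close> c0 by (auto simp: k_def)
    have "z = cis (\<theta> - c * k) * cis (c * k)"
      using \<open>z = cis \<theta>\<close> by (simp add: cis_mult)
    then have "poly F z = poly F (cis (\<theta> - c * k))"
      by (simp only: rots)
    moreover have "\<theta> - c * k \<in> {0..c}"
      using k c0 by (auto simp: field_simps)
    ultimately show ?thesis
      using y(2) by simp
  qed
  then have "cmod (coeff F 0) \<le> cmod (poly F (cis y))"
    by (rule norm_coeff_le_circle)
  moreover have "coeff F 0 = coeff p 0 ^ M"
    using F[of 0] by (simp add: poly_0_coeff_0)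
  ultimately show ?thesis
    using that[OF y(1)] by (simp add: F cis_mult norm_power prod_norm)
qed

text \<open>The logarithm of the bound in \<open>exists_prod_rotations_ge\<close> bounds a Riemann
  sum of \<open>ln (g x)\<close> from below. The positive continuous majorant \<open>g\<close>
  stands in for the modulus of \<open>p\<close>, so zeros of \<open>p\<close> on the circle create
  no singularity.\<close>

lemma jensen_coeff_0:
  fixes p :: "complex poly" and g :: "real \<Rightarrow> real"
  assumes cont: "continuous_on {0..2 * pi} g"
    and pos: "\<And>x. x \<in> {0..2 * pi} \<Longrightarrow> g x > 0"
    and ge: "\<And>x. x \<in> {0..2 * pi} \<Longrightarrow> cmod (poly p (cis x)) \<le> g x"
    and "coeff p 0 \<noteq> 0"
  shows "2 * pi * ln (cmod (coeff p 0)) \<le> integral {0..2 * pi} (\<lambda>x. ln (g x))"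
proof (rule field_le_epsilon)
  fix e :: real assume "e > 0"
  define \<epsilon> where "\<epsilon> = e / (2 * pi)"
  have "\<epsilon> > 0"
    using \<open>e > 0\<close> by (simp add: \<epsilon>_def)
  have lncont: "continuous_on {0..2 * pi} (\<lambda>x. ln (g x))"
    using pos by (intro continuous_on_ln cont) (auto simp: less_le)
  have "uniformly_continuous_on {0..2 * pi} (\<lambda>x. ln (g x))"
    by (rule compact_uniformly_continuous[OF lncont]) simp
  then obtain d where d: "d > 0"
      "\<And>s t. s \<in> {0..2 * pi} \<Longrightarrow> t \<in> {0..2 * pi} \<Longrightarrow> \<bar>s - t\<bar> < d \<Longrightarrow> \<bar>ln (g s) - ln (g t)\<bar> < \<epsilon>"
    using \<open>\<epsilon> > 0\<close> unfolding uniformly_continuous_on_def dist_real_def by metis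
  obtain M :: nat where M: "2 * pi / d < real M"
    using reals_Archimedean2 by blast
  have "0 < real M"
    using M d(1) by (intro le_less_trans[OF _ M]) auto
  then have M0: "M > 0"
    by simp
  define c where "c = 2 * pi / real M"
  have c: "0 < c" "c < d" "c * M = 2 * pi"
    using M d(1) M0 by (auto simp: c_def field_simps)
  obtain y where y: "y \<in> {0..c}"
      "cmod (coeff p 0) ^ M \<le> (\<Prod>r<M. cmod (poly p (cis (y + c * real r))))"
    using exists_prod_rotations_ge[OF M0 c_def] by blast
  have in_range: "y + c * r \<in> {0..2 * pi}" if "r < M" for r
  proof -
    have "c * (real r + 1) \<le> c * M"
      using that c(1) by (intro mult_left_mono) auto
    then show ?thesis
      using y(1) c by (auto simp: algebra_simps)
  qed
  have pos0: "0 < cmod (coeff p 0) ^ M"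
    using \<open>coeff p 0 \<noteq> 0\<close> by simp
  have "(\<Prod>r<M. cmod (poly p (cis (y + c * real r)))) \<le> (\<Prod>r<M. g (y + c * real r))"
    using ge in_range by (intro prod_mono) auto
  then have "ln (cmod (coeff p 0) ^ M) \<le> ln (\<Prod>r<M. g (y + c * real r))"
    using y(2) pos0 by (intro ln_mono) auto
  also have "\<dots> = (\<Sum>r<M. ln (g (y + c * real r)))"
    using pos[OF in_range] by (intro ln_prod) (auto simp: less_le)
  finally have "M * ln (cmod (coeff p 0)) \<le> (\<Sum>r<M. ln (g (y + c * real r)))"
    using \<open>coeff p 0 \<noteq> 0\<close> by (simp add: ln_realpow)
  then have "c * (M * ln (cmod (coeff p 0))) \<le> c * (\<Sum>r<M. ln (g (y + c * real r)))"
    using c(1) by (intro mult_left_mono) auto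
  moreover have "c * (\<Sum>r<M. ln (g (y + c * real r))) - 2 * pi * \<epsilon> \<le> integral {0..2 * pi} (\<lambda>x. ln (g x))"
  proof (rule integral_ge_shifted_riemann_sum[OF lncont M0 c_def _ y(1)])
    fix s t assume "s \<in> {0..2 * pi}" "t \<in> {0..2 * pi}" "\<bar>s - t\<bar> \<le> c"
    then show "\<bar>ln (g s) - ln (g t)\<bar> \<le> \<epsilon>"
      using d(2)[of s t] c(2) by linarith
  qed simp
  ultimately show "2 * pi * ln (cmod (coeff p 0)) \<le> integral {0..2 * pi} (\<lambda>x. ln (g x)) + e"
    using c(3) by (simp add: \<epsilon>_def flip: mult.assoc)
qed

text \<open>On the unit circle \<open>\<bar>p z\<bar> = \<bar>z\<^sup>n cnj (p (1 / cnj z))\<bar>\<close>, which turns the leading coefficient into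
  a constant one.\<close>

lemma jensen_lead_coeff:
  fixes p :: "complex poly" and g :: "real \<Rightarrow> real"
  assumes "continuous_on {0..2 * pi} g"
    and "\<And>x. x \<in> {0..2 * pi} \<Longrightarrow> g x > 0"
    and ge: "\<And>x. x \<in> {0..2 * pi} \<Longrightarrow> cmod (poly p (cis x)) \<le> g x"
    and "p \<noteq> 0"
  shows "2 * pi * ln (cmod (lead_coeff p)) \<le> integral {0..2 * pi} (\<lambda>x. ln (g x))"
proof -
  define r where "r = reflect_poly (map_poly cnj p)"
  have r0: "coeff r 0 = cnj (lead_coeff p)"
    by (simp add: r_def degree_map_poly coeff_map_poly)
  have "cmod (poly r (cis x)) = cmod (poly p (cis x))" for x
  proof -
    have "inverse (cis x) = cnj (cis x)"
      by (simp add: cis_cnj cis_inverse)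
    then have "cmod (poly r (cis x)) = cmod (poly (map_poly cnj p) (cnj (cis x)))"
      by (simp add: r_def poly_reflect_poly_nz norm_mult norm_power)
    also have "poly (map_poly cnj p) (cnj (cis x)) = cnj (poly p (cis x))"
      by simp
    finally show ?thesis
      by simp
  qed
  then have "2 * pi * ln (cmod (coeff r 0)) \<le> integral {0..2 * pi} (\<lambda>x. ln (g x))"
    using assms r0 by (intro jensen_coeff_0) auto
  then show ?thesis
    by (simp add: r0)
qed

section \<open>The Lyapunov exponent\<close>

lemma transfer_matrix_Suc_nth:
  "transfer_matrix lam \<alpha> E (Suc n) x $ 1 $ j
    = (E - of_real lam * cis (x + n * \<alpha>)) * transfer_matrix lam \<alpha> E n x $ 1 $ j
      - transfer_matrix lam \<alpha> E n x $ 2 $ j"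
  "transfer_matrix lam \<alpha> E (Suc n) x $ 2 $ j = transfer_matrix lam \<alpha> E n x $ 1 $ j"
  by (simp_all add: step_matrix_def matrix_matrix_mult_def sum_2)

lemma cis_orbit: "of_real lam * cis (x + real n * \<alpha>) = cis \<alpha> ^ n * (of_real lam * cis x)"
  by (simp only: Complex.DeMoivre mult_ac flip: cis_mult)

lemma transfer_matrix_column_1:
  "transfer_matrix lam \<alpha> E n x $ 1 $ 1 = hill_det (cis \<alpha>) E (of_real lam * cis x) n"
proof (induction n rule: induct_nat_012)
  case (ge2 n)
  show ?case
    unfolding transfer_matrix_Suc_nth[of _ _ _ "Suc n"] transfer_matrix_Suc_nth(2)[of _ _ _ n] ge2
    by (simp add: cis_orbit del: of_nat_Suc)
qed (simp_all add: mat_def step_matrix_def matrix_matrix_mult_def sum_2)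

text \<open>The first step sends the second unit vector to minus the first one; what remains are
  \<open>n\<close> steps of the first column started at \<open>x + \<alpha>\<close>.\<close>

lemma transfer_matrix_column_2:
  "transfer_matrix lam \<alpha> E (Suc n) x $ 1 $ 2
    = - hill_det (cis \<alpha>) E (of_real lam * cis (x + \<alpha>)) n"
proof (induction n rule: induct_nat_012)
  case 0
  show ?case
    by (simp add: mat_def transfer_matrix_Suc_nth del: transfer_matrix.simps(2))
next
  case 1
  show ?case
    by (simp add: mat_def transfer_matrix_Suc_nth del: transfer_matrix.simps(2))
next
  case (ge2 n)
  have orbit: "of_real lam * cis (x + real (Suc (Suc n)) * \<alpha>)
      = cis \<alpha> ^ Suc n * (of_real lam * cis (x + \<alpha>))"
    using cis_orbit[of lam "x + \<alpha>" "Suc n" \<alpha>] by (simp add: algebra_simps)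
  show ?case
    unfolding transfer_matrix_Suc_nth(1)[of _ _ _ "Suc (Suc n)"]
      transfer_matrix_Suc_nth(2)[of _ _ _ "Suc n"] ge2 orbit
    by (simp add: algebra_simps)
qed

section \<open>Operator norm of the transfer matrices: entrywise bound, continuity,
  positivity\<close>

lemma onorm_le_sum_entries:
  fixes A :: "complex^'n^'m"
  shows "onorm ((*v) A) \<le> (\<Sum>i\<in>UNIV. \<Sum>j\<in>UNIV. cmod (A $ i $ j))"
proof (rule onorm_le)
  fix v
  have "norm (A *v v) \<le> (\<Sum>i\<in>UNIV. cmod ((A *v v) $ i))"
    by (simp add: norm_vec_def L2_set_le_sum)
  also have "\<dots> \<le> (\<Sum>i\<in>UNIV. \<Sum>j\<in>UNIV. cmod (A $ i $ j) * norm v)"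
  proof (rule sum_mono)
    fix i
    have "cmod ((A *v v) $ i) \<le> (\<Sum>j\<in>UNIV. cmod (A $ i $ j * v $ j))"
      by (simp add: matrix_vector_mult_def sum_norm_le)
    also have "\<dots> \<le> (\<Sum>j\<in>UNIV. cmod (A $ i $ j) * norm v)"
      by (intro sum_mono) (simp add: norm_mult mult_left_mono Finite_Cartesian_Product.norm_nth_le)
    finally show "cmod ((A *v v) $ i) \<le> (\<Sum>j\<in>UNIV. cmod (A $ i $ j) * norm v)" .
  qed
  finally show "norm (A *v v) \<le> (\<Sum>i\<in>UNIV. \<Sum>j\<in>UNIV. cmod (A $ i $ j)) * norm v"
    by (simp add: sum_distrib_right)
qed

lemma onorm_matrix_le_diff:
  fixes A B :: "complex^'n^'m"
  shows "onorm ((*v) A) - onorm ((*v) B) \<le> onorm ((*v) (A - B))"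
proof -
  have "onorm (\<lambda>v. (A - B) *v v + B *v v) \<le> onorm ((*v) (A - B)) + onorm ((*v) B)"
    by (rule onorm_triangle) auto
  then show ?thesis
    by (simp add: matrix_vector_mult_diff_rdistrib)
qed

lemma continuous_on_onorm_matrix:
  fixes A :: "'a::topological_space \<Rightarrow> complex^'n^'m"
  assumes "\<And>i j. continuous_on S (\<lambda>x. A x $ i $ j)"
  shows "continuous_on S (\<lambda>x. onorm ((*v) (A x)))"
  unfolding continuous_on_def
proof
  fix y assume "y \<in> S"
  define D where "D = (\<lambda>x. \<Sum>i\<in>UNIV. \<Sum>j\<in>UNIV. cmod (A x $ i $ j - A y $ i $ j))"
  have "(D \<longlongrightarrow> D y) (at y within S)"
    unfolding D_def using assms \<open>y \<in> S\<close>
    by (intro tendsto_sum tendsto_norm tendsto_diff tendsto_const) (auto simp: continuous_on_def)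
  then have D: "(D \<longlongrightarrow> 0) (at y within S)"
    by (simp add: D_def)
  have "norm (onorm ((*v) (A x)) - onorm ((*v) (A y))) \<le> D x" for x
  proof -
    have "onorm ((*v) (A x - A y)) \<le> D x"
      using onorm_le_sum_entries[of "A x - A y"] by (simp add: D_def)
    moreover have "onorm ((*v) (A y - A x)) \<le> D x"
      using onorm_le_sum_entries[of "A y - A x"] by (simp add: D_def norm_minus_commute)
    ultimately show ?thesis
      using onorm_matrix_le_diff[of "A x" "A y"] onorm_matrix_le_diff[of "A y" "A x"] by simp
  qed
  then have "((\<lambda>x. onorm ((*v) (A x)) - onorm ((*v) (A y))) \<longlongrightarrow> 0) (at y within S)"
    by (intro Lim_null_comparison[OF _ D]) simp
  then show "((\<lambda>x. onorm ((*v) (A x))) \<longlongrightarrow> onorm ((*v) (A y))) (at y within S)"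
    by (rule LIM_zero_cancel)
qed

lemma continuous_on_transfer_matrix_nth:
  "continuous_on S (\<lambda>x. transfer_matrix lam \<alpha> E n x $ i $ j)"
proof (induction n arbitrary: i)
  case (Suc n)
  have "continuous_on S (\<lambda>x. transfer_matrix lam \<alpha> E (Suc n) x $ 1 $ j)"
       "continuous_on S (\<lambda>x. transfer_matrix lam \<alpha> E (Suc n) x $ 2 $ j)"
    unfolding transfer_matrix_Suc_nth by (intro continuous_intros Suc)+
  then show ?case
    using exhaust_2[of i] by auto
qed simp

lemma det_transfer_matrix: "det (transfer_matrix lam \<alpha> E n x) = 1"
proof (induction n)
  case (Suc n)
  have "det (step_matrix lam E y) = 1" for y
    by (simp add: step_matrix_def det_2)
  then show ?case
    using Suc by (simp add: det_mul)
qed simp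

definition transfer_norm :: "real \<Rightarrow> real \<Rightarrow> complex \<Rightarrow> nat \<Rightarrow> real \<Rightarrow> real" where
  "transfer_norm lam \<alpha> E n x = onorm ((*v) (transfer_matrix lam \<alpha> E n x))"

text \<open>A matrix of determinant one is nonzero. Positivity makes the logarithm of the norm
  continuous in \<open>x\<close>.\<close>

lemma transfer_norm_pos: "transfer_norm lam \<alpha> E n x > 0"
proof (rule ccontr)
  assume "\<not> transfer_norm lam \<alpha> E n x > 0"
  then have "onorm ((*v) (transfer_matrix lam \<alpha> E n x)) = 0"
    using onorm_pos_le[of "(*v) (transfer_matrix lam \<alpha> E n x)"] by (simp add: transfer_norm_def)
  then have "transfer_matrix lam \<alpha> E n x *v v = 0" for v
    by (simp add: onorm_eq_0)
  then have "transfer_matrix lam \<alpha> E n x = 0"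
    by (simp add: matrix_eq)
  then show False
    using det_transfer_matrix[of lam \<alpha> E n x] by (simp add: det_2)
qed

lemma continuous_on_transfer_norm: "continuous_on S (transfer_norm lam \<alpha> E n)"
  using continuous_on_onorm_matrix[OF continuous_on_transfer_matrix_nth]
  by (simp add: transfer_norm_def[abs_def])

lemma continuous_on_ln_transfer_norm: "continuous_on S (\<lambda>x. ln (transfer_norm lam \<alpha> E n x))"
  by (intro continuous_on_ln continuous_on_transfer_norm ballI)
    (metis transfer_norm_pos less_irrefl)

text \<open>The integrand is continuous, so the Lebesgue and gauge integrals agree, and the endpoint
  is negligible. At \<open>n = 0\<close> both sides are zero through division by zero.\<close>

lemma lyapunov_mean_eq:
  "lyapunov_mean lam \<alpha> E n
    = integral {0..2 * pi} (\<lambda>x. ln (transfer_norm lam \<alpha> E n x)) / (2 * pi * n)"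
proof -
  let ?f = "\<lambda>x. ln (transfer_norm lam \<alpha> E n x)"
  have "set_integrable lborel {0..2 * pi} ?f"
    by (rule borel_integrable_atLeastAtMost') (rule continuous_on_ln_transfer_norm)
  then have "set_integrable lborel {0..<2 * pi} ?f"
    by (rule set_integrable_subset) auto
  then have "(LINT x:{0..<2 * pi}|lborel. ?f x) = integral {0..<2 * pi} ?f"
    by (rule set_borel_integral_eq_integral)
  also have "\<dots> = integral {0..2 * pi} ?f"
    by (rule integral_spike_set; rule negligible_subset[of "{2 * pi}"]) auto
  finally show ?thesis
    by (simp add: lyapunov_mean_def transfer_norm_def)
qed

text \<open>With \<open>E = w + 1/w\<close>, the vector \<open>(w, 1)\<close> is an eigenvector of the transfer matrix at zero
  potential; \<open>eigen_poly\<close> is the first component of its image as a polynomial in \<open>exp (i x)\<close>.\<close>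

fun eigen_poly :: "complex \<Rightarrow> complex \<Rightarrow> complex \<Rightarrow> nat \<Rightarrow> complex poly" where
  "eigen_poly q c w 0 = [:w:]"
| "eigen_poly q c w (Suc 0) = [:w\<^sup>2, - (c * w):]"
| "eigen_poly q c w (Suc (Suc n)) =
     [:w + inverse w, - (c * q ^ Suc n):] * eigen_poly q c w (Suc n) - eigen_poly q c w n"

lemma matrix_vector_mult_vector_2:
  fixes A :: "complex^2^'m"
  shows "(A *v vector [a, b]) $ i = A $ i $ 1 * a + A $ i $ 2 * b"
  by (simp add: matrix_vector_mult_def sum_2)

lemma poly_eigen_poly:
  assumes "w \<noteq> 0"
  shows "poly (eigen_poly (cis \<alpha>) (of_real lam) w n) (cis x)
    = (transfer_matrix lam \<alpha> (w + inverse w) n x *v vector [w, 1]) $ 1"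
proof (induction n rule: induct_nat_012)
  case 1
  show ?case
    using assms
    by (simp add: matrix_vector_mult_vector_2 transfer_matrix_Suc_nth mat_def algebra_simps
        power2_eq_square del: transfer_matrix.simps(2))
next
  case (ge2 n)
  then show ?case
    unfolding matrix_vector_mult_vector_2 transfer_matrix_Suc_nth(1)[of _ _ _ "Suc n"]
      transfer_matrix_Suc_nth(2)[of _ _ _ n] cis_orbit
    by (simp add: algebra_simps del: transfer_matrix.simps(2) of_nat_Suc)
qed (simp add: matrix_vector_mult_vector_2 mat_def)

lemma coeff_0_eigen_poly:
  assumes "w \<noteq> 0"
  shows "coeff (eigen_poly q c w n) 0 = w ^ Suc n"
proof (induction n rule: induct_nat_012)
  case (ge2 n)
  then show ?case
    using assms by (simp add: field_simps)
qed (simp_all add: power2_eq_square)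

lemma degree_eigen_poly_le: "degree (eigen_poly q c w n) \<le> n"
proof (induction n rule: induct_nat_012)
  case (ge2 n)
  have "degree ([:w + inverse w, - (c * q ^ Suc n):] * eigen_poly q c w (Suc n)) \<le> 1 + Suc n"
    by (rule order_trans[OF degree_mult_le], rule add_mono) (auto intro: ge2)
  then show ?case
    using ge2 by (auto intro!: degree_diff_le)
qed auto

lemma coeff_top_eigen_poly:
  "coeff (eigen_poly q c w n) n = w * (- c) ^ n * q ^ (n choose 2)"
proof (induction n rule: induct_nat_012)
  case (ge2 n)
  have "coeff (eigen_poly q c w n) (Suc (Suc n)) = 0"
    "coeff (eigen_poly q c w (Suc n)) (Suc (Suc n)) = 0"
    using degree_eigen_poly_le[of q c w n] degree_eigen_poly_le[of q c w "Suc n"]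
    by (auto intro!: coeff_eq_0)
  then show ?case
    using ge2(2) by (simp add: choose_two_Suc[of "Suc n"] power_add)
qed (simp_all add: binomial_eq_0)

text \<open>The norm of the matrix times that of the vector \<open>(w, 1)\<close> majorizes
  \<open>p\<close> on the circle. Jensen's inequality at the constant coefficient
  \<open>w ^ Suc n\<close> gives the first bound, and at the leading coefficient, of modulus
  \<open>cmod w * \<bar>lam\<bar> ^ n\<close>, the second.\<close>

lemma integral_ln_transfer_norm_ge:
  assumes "w \<noteq> 0" "lam \<noteq> 0" "E = w + inverse w"
  shows "2 * pi * (ln (cmod w) * Suc n - ln (norm (vector [w, 1] :: complex^2)))
      \<le> integral {0..2 * pi} (\<lambda>x. ln (transfer_norm lam \<alpha> E n x))"
    and "2 * pi * (ln \<bar>lam\<bar> * n + ln (cmod w) - ln (norm (vector [w, 1] :: complex^2)))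
      \<le> integral {0..2 * pi} (\<lambda>x. ln (transfer_norm lam \<alpha> E n x))"
proof -
  define v :: "complex^2" where "v = vector [w, 1]"
  define p where "p = eigen_poly (cis \<alpha>) (of_real lam) w n"
  define g where "g = (\<lambda>x. transfer_norm lam \<alpha> E n x * norm v)"
  have "v $ 2 \<noteq> 0"
    by (simp add: v_def)
  then have v: "norm v > 0"
    by auto
  have cont: "continuous_on {0..2 * pi} g"
    unfolding g_def by (intro continuous_intros continuous_on_transfer_norm)
  have pos: "g x > 0" for x
    using v transfer_norm_pos by (simp add: g_def)
  have ge: "cmod (poly p (cis x)) \<le> g x" for x
  proof -
    have "cmod (poly p (cis x)) \<le> norm (transfer_matrix lam \<alpha> E n x *v v)"
      unfolding p_def poly_eigen_poly[OF assms(1)] assms(3) v_def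
      by (rule Finite_Cartesian_Product.norm_nth_le)
    also have "\<dots> \<le> g x"
      unfolding g_def transfer_norm_def by (rule onorm) simp
    finally show ?thesis .
  qed
  have "integral {0..2 * pi} (\<lambda>x. ln (g x))
      = integral {0..2 * pi} (\<lambda>x. ln (transfer_norm lam \<alpha> E n x) + ln (norm v))"
    using v transfer_norm_pos[of lam \<alpha> E n] by (simp add: g_def ln_mult_pos)
  also have "\<dots> = integral {0..2 * pi} (\<lambda>x. ln (transfer_norm lam \<alpha> E n x)) + 2 * pi * ln (norm v)"
    by (subst Henstock_Kurzweil_Integration.integral_add)
      (auto intro!: integrable_continuous_real continuous_on_ln_transfer_norm)
  finally have int: "integral {0..2 * pi} (\<lambda>x. ln (g x))
      = integral {0..2 * pi} (\<lambda>x. ln (transfer_norm lam \<alpha> E n x)) + 2 * pi * ln (norm v)" .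
  have c0: "coeff p 0 = w ^ Suc n"
    unfolding p_def by (rule coeff_0_eigen_poly[OF assms(1)])
  have cn: "coeff p n = w * (- of_real lam) ^ n * cis \<alpha> ^ (n choose 2)"
    unfolding p_def by (rule coeff_top_eigen_poly)
  have "coeff p n \<noteq> 0"
    using assms(1,2) by (simp add: cn)
  then have "degree p = n"
    using degree_eigen_poly_le[of "cis \<alpha>" "of_real lam" w n] le_degree[of p n]
    by (simp add: p_def)
  have "p \<noteq> 0"
    using \<open>coeff p n \<noteq> 0\<close> by auto
  have "2 * pi * ln (cmod (coeff p 0)) \<le> integral {0..2 * pi} (\<lambda>x. ln (g x))"
    using cont pos ge by (rule jensen_coeff_0) (use assms(1) in \<open>simp add: c0\<close>)
  moreover have "ln (cmod (coeff p 0)) = ln (cmod w) * Suc n"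
    using assms(1) unfolding c0 norm_power by (subst ln_realpow) auto
  ultimately show "2 * pi * (ln (cmod w) * Suc n - ln (norm (vector [w, 1] :: complex^2)))
      \<le> integral {0..2 * pi} (\<lambda>x. ln (transfer_norm lam \<alpha> E n x))"
    unfolding int v_def [symmetric] by (simp add: algebra_simps)
  have "2 * pi * ln (cmod (lead_coeff p)) \<le> integral {0..2 * pi} (\<lambda>x. ln (g x))"
    using cont pos ge \<open>p \<noteq> 0\<close> by (rule jensen_lead_coeff)
  moreover have "ln (cmod (lead_coeff p)) = ln \<bar>lam\<bar> * n + ln (cmod w)"
    using assms(1,2) unfolding \<open>degree p = n\<close> cn
    by (simp add: norm_mult norm_power ln_mult_pos ln_realpow)
  ultimately show "2 * pi * (ln \<bar>lam\<bar> * n + ln (cmod w) - ln (norm (vector [w, 1] :: complex^2)))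
      \<le> integral {0..2 * pi} (\<lambda>x. ln (transfer_norm lam \<alpha> E n x))"
    unfolding int v_def [symmetric] by (simp add: algebra_simps)
qed

section \<open>Upper bound uniform in the phase, and the limit of the means\<close>

lemma transfer_norm_le:
  assumes w: "cmod w \<ge> 1" and C: "C > 0" "\<epsilon> > 0"
    and B: "\<And>n k. cmod (qbinom (cis \<alpha>) n k) \<le> C * exp (\<epsilon> * n)"
    and "n > 0"
  shows "transfer_norm lam \<alpha> (w + inverse w) n x
    \<le> 16 * C\<^sup>2 * (real n)\<^sup>2 * exp (2 * \<epsilon> * n) * max (cmod w) \<bar>lam\<bar> ^ n"
proof -
  define M where "M = max (cmod w) \<bar>lam\<bar>"
  define R where "R = (\<lambda>n. (real (Suc n))\<^sup>2 * C\<^sup>2 * exp (2 * \<epsilon> * n) * M ^ n)"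
  let ?T = "transfer_matrix lam \<alpha> (w + inverse w)"
  have "M \<ge> 1"
    using w by (simp add: M_def)
  have R_mono: "R m \<le> R n" if "m \<le> n" for m n
    unfolding R_def using that \<open>M \<ge> 1\<close> C
    by (intro mult_mono power_mono power_increasing) auto
  have R_nonneg: "0 \<le> R n" for n
    using \<open>M \<ge> 1\<close> by (simp add: R_def)
  have det: "cmod (hill_det (cis \<alpha>) (w + inverse w) (of_real lam * cis y) m) \<le> R n"
    if "m \<le> n" for y m n
  proof -
    have "cmod (hill_det (cis \<alpha>) (w + inverse w) (of_real lam * cis y) m) \<le> R m"
      using norm_hill_det_le[of "cis \<alpha>" w C \<epsilon> "of_real lam * cis y" m] w C B
      by (simp add: R_def M_def norm_mult)
    then show ?thesis
      using R_mono[OF that] by linarith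
  qed
  obtain m where m: "n = Suc m"
    using \<open>n > 0\<close> gr0_conv_Suc by blast
  have entry12: "cmod (?T k x $ 1 $ 2) \<le> R n" if "k \<le> n" for k
    using that det R_nonneg by (cases k) (simp_all add: transfer_matrix_column_2 mat_def del: transfer_matrix.simps(2))
  have entry11: "cmod (?T k x $ 1 $ 1) \<le> R n" if "k \<le> n" for k
    using that det by (simp add: transfer_matrix_column_1)
  have "transfer_norm lam \<alpha> (w + inverse w) n x \<le> (\<Sum>i\<in>UNIV. \<Sum>j\<in>UNIV. cmod (?T n x $ i $ j))"
    unfolding transfer_norm_def by (rule onorm_le_sum_entries)
  \<comment> \<open>The second row is the first row one step earlier, so bounds on first rows at
    \<open>n\<close> and \<open>m = n - 1\<close> suffice.\<close>
  also have "\<dots> = cmod (?T n x $ 1 $ 1) + cmod (?T n x $ 1 $ 2) + cmod (?T m x $ 1 $ 1) + cmod (?T m x $ 1 $ 2)"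
    by (simp only: sum_2 m transfer_matrix_Suc_nth(2))
  also have "\<dots> \<le> R n + R n + R n + R n"
    by (intro add_mono entry11 entry12) (use m in auto)
  also have "\<dots> = 4 * (real (Suc n))\<^sup>2 * (C\<^sup>2 * exp (2 * \<epsilon> * n) * M ^ n)"
    by (simp add: R_def)
  \<comment> \<open>Using \<open>Suc n \<le> 2 * n\<close>, the polynomial factor becomes a pure
    power of \<open>n\<close>, whose logarithm is a multiple of \<open>ln n\<close>.\<close>
  also have "\<dots> \<le> 4 * (2 * real n)\<^sup>2 * (C\<^sup>2 * exp (2 * \<epsilon> * n) * M ^ n)"
    using \<open>n > 0\<close> \<open>M \<ge> 1\<close> by (intro mult_right_mono mult_left_mono power_mono) auto
  finally show ?thesis
    by (simp add: M_def power_mult_distrib mult_ac)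
qed

lemma lyapunov_mean_tendsto:
  assumes irr: "\<alpha> / (2 * pi) \<notin> \<rat>" and "lam \<noteq> 0" and w: "cmod w \<ge> 1" and E: "E = w + inverse w"
  shows "lyapunov_mean lam \<alpha> E \<longlonglongrightarrow> max (ln (cmod w)) (ln \<bar>lam\<bar>)"
proof -
  define l where "l = max (ln (cmod w)) (ln \<bar>lam\<bar>)"
  define V where "V = ln (norm (vector [w, 1] :: complex^2))"
  have "w \<noteq> 0"
    using w by auto
  have l: "ln (max (cmod w) \<bar>lam\<bar>) = l"
    using \<open>w \<noteq> 0\<close> \<open>lam \<noteq> 0\<close> by (auto simp: l_def max_def)
  show ?thesis
    unfolding l_def [symmetric]
  proof (rule order_tendstoI)
    fix a assume "a < l"
    \<comment> \<open>Both Jensen bounds, divided by \<open>n\<close>, carry the same error term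
      \<open>(ln (cmod w) - V) / n\<close>.\<close>
    have "(\<lambda>n. ln (cmod w) + (ln (cmod w) - V) * inverse (real n)) \<longlonglongrightarrow> ln (cmod w) + (ln (cmod w) - V) * 0"
      "(\<lambda>n. ln \<bar>lam\<bar> + (ln (cmod w) - V) * inverse (real n)) \<longlonglongrightarrow> ln \<bar>lam\<bar> + (ln (cmod w) - V) * 0"
      by (intro tendsto_intros LIMSEQ_inverse_real_of_nat lim_inverse_n)+
    from tendsto_max[OF this]
    have "(\<lambda>n. max (ln (cmod w) + (ln (cmod w) - V) * inverse (real n))
        (ln \<bar>lam\<bar> + (ln (cmod w) - V) * inverse (real n))) \<longlonglongrightarrow> l"
      by (simp add: l_def)
    then have "\<forall>\<^sub>F n in sequentially. a < max (ln (cmod w) + (ln (cmod w) - V) * inverse (real n))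
        (ln \<bar>lam\<bar> + (ln (cmod w) - V) * inverse (real n))"
      using \<open>a < l\<close> by (rule order_tendstoD)
    then show "\<forall>\<^sub>F n in sequentially. a < lyapunov_mean lam \<alpha> E n"
      using eventually_gt_at_top[of 0]
    proof eventually_elim
      case (elim n)
      have mean_ge: "b / n \<le> lyapunov_mean lam \<alpha> E n"
        if "2 * pi * b \<le> integral {0..2 * pi} (\<lambda>x. ln (transfer_norm lam \<alpha> E n x))" for b
        using divide_right_mono[OF that, of "2 * pi * n"] by (simp add: lyapunov_mean_eq)
      have "ln (cmod w) + (ln (cmod w) - V) * inverse (real n) \<le> lyapunov_mean lam \<alpha> E n"
        using mean_ge[OF integral_ln_transfer_norm_ge(1)[OF \<open>w \<noteq> 0\<close> \<open>lam \<noteq> 0\<close> E, of n \<alpha>]] elim(2)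
        by (simp add: V_def field_simps)
      moreover have "ln \<bar>lam\<bar> + (ln (cmod w) - V) * inverse (real n) \<le> lyapunov_mean lam \<alpha> E n"
        using mean_ge[OF integral_ln_transfer_norm_ge(2)[OF \<open>w \<noteq> 0\<close> \<open>lam \<noteq> 0\<close> E, of n \<alpha>]] elim(2)
        by (simp add: V_def field_simps)
      ultimately show ?case
        using elim(1) by linarith
    qed
  next
    fix a assume "l < a"
    \<comment> \<open>The exponential rate of the upper bound is \<open>l + 2 * \<epsilon>\<close>,
      the midpoint of \<open>l\<close> and \<open>a\<close>.\<close>
    define \<epsilon> where "\<epsilon> = (a - l) / 4"
    have "\<epsilon> > 0"
      using \<open>l < a\<close> by (simp add: \<epsilon>_def)
    obtain C where C: "C > 0" "\<And>n k. cmod (qbinom (cis \<alpha>) n k) \<le> C * exp (\<epsilon> * n)"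
      using norm_qbinom_subexponential[of "cis \<alpha>" \<epsilon>] cis_power_neq_1[OF irr] \<open>\<epsilon> > 0\<close> by auto
    have "(\<lambda>n. ln (16 * C\<^sup>2) * inverse (real n) + 2 * (ln (real n) / real n) + 2 * \<epsilon> + l)
        \<longlonglongrightarrow> ln (16 * C\<^sup>2) * 0 + 2 * 0 + 2 * \<epsilon> + l"
      by (intro tendsto_intros lim_inverse_n lim_ln_over_n)
    moreover have "ln (16 * C\<^sup>2) * 0 + 2 * 0 + 2 * \<epsilon> + l < a"
      using \<open>l < a\<close> by (simp add: \<epsilon>_def field_simps)
    ultimately have "\<forall>\<^sub>F n in sequentially.
        ln (16 * C\<^sup>2) * inverse (real n) + 2 * (ln (real n) / real n) + 2 * \<epsilon> + l < a"
      by (rule order_tendstoD)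
    then show "\<forall>\<^sub>F n in sequentially. lyapunov_mean lam \<alpha> E n < a"
      using eventually_gt_at_top[of 0]
    proof eventually_elim
      case (elim n)
      let ?B = "ln (16 * C\<^sup>2) + 2 * ln (real n) + 2 * \<epsilon> * n + l * n"
      have "ln (transfer_norm lam \<alpha> E n x) \<le> ?B" for x
      proof -
        have "ln (transfer_norm lam \<alpha> E n x)
            \<le> ln (16 * C\<^sup>2 * (real n)\<^sup>2 * exp (2 * \<epsilon> * n) * max (cmod w) \<bar>lam\<bar> ^ n)"
          using transfer_norm_le[OF w C(1) \<open>\<epsilon> > 0\<close> C(2) elim(2), of lam x]
          unfolding E by (intro ln_mono transfer_norm_pos)
        also have "\<dots> = ?B"
          using C(1) elim(2) \<open>w \<noteq> 0\<close> l
          by (simp add: ln_mult_pos ln_realpow less_max_iff_disj)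
        finally show ?thesis .
      qed
      then have "integral {0..2 * pi} (\<lambda>x. ln (transfer_norm lam \<alpha> E n x)) \<le> integral {0..2 * pi} (\<lambda>_. ?B)"
        by (intro integral_le integrable_continuous_real continuous_on_ln_transfer_norm continuous_on_const)
      then have "integral {0..2 * pi} (\<lambda>x. ln (transfer_norm lam \<alpha> E n x)) \<le> 2 * pi * ?B"
        by simp
      from divide_right_mono[OF this, of "2 * pi * n"]
      have "lyapunov_mean lam \<alpha> E n \<le> ?B / n"
        by (simp add: lyapunov_mean_eq)
      also have "\<dots> = ln (16 * C\<^sup>2) * inverse (real n) + 2 * (ln (real n) / real n) + 2 * \<epsilon> + l"
        using elim(2) by (simp add: field_simps)
      also have "\<dots> < a"
        by (rule elim(1))
      finally show ?case .
    qed
  qed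
qed

section \<open>Operators with exponentially decaying kernels\<close>

definition decay :: "real \<Rightarrow> int \<Rightarrow> real" where
  "decay \<theta> n = \<theta> ^ nat \<bar>n\<bar>"

lemma decay_nonneg: "0 \<le> \<theta> \<Longrightarrow> 0 \<le> decay \<theta> n"
  by (simp add: decay_def)

lemma decay_minus [simp]: "decay \<theta> (- n) = decay \<theta> n"
  by (simp add: decay_def)

lemma summable_on_decay:
  assumes "0 \<le> \<theta>" "\<theta> < 1"
  shows "decay \<theta> summable_on UNIV"
proof -
  have geo: "(\<lambda>n. \<theta> ^ n) summable_on UNIV"
    using assms by (intro norm_summable_imp_summable_on) (simp add: summable_geometric)
  have "decay \<theta> summable_on range int"
    using geo by (subst summable_on_reindex) (auto simp: o_def decay_def)
  moreover have "decay \<theta> summable_on range (\<lambda>n. - int n)"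
    using geo by (subst summable_on_reindex) (auto simp: o_def decay_def inj_on_def)
  moreover have "x \<in> range int \<union> range (\<lambda>n. - int n)" for x
    by (cases x rule: int_cases2) auto
  then have "range int \<union> range (\<lambda>n. - int n) = UNIV"
    by blast
  ultimately show ?thesis
    using summable_on_union by metis
qed

lemma bij_int_shift: "bij (\<lambda>m. m + (c::int))"
  by (rule bij_betwI[of _ _ _ "\<lambda>m. m - c"]) auto

lemma bij_int_reflect: "bij (\<lambda>m. (c::int) - m)"
  by (rule bij_betwI[of _ _ _ "\<lambda>m. c - m"]) auto

lemma infsum_int_shift: "infsum (\<lambda>m. f (m + (c::int))) UNIV = infsum f UNIV"
  by (rule infsum_reindex_bij_betw) (rule bij_int_shift)

lemma infsum_int_reflect: "infsum (\<lambda>m. f ((c::int) - m)) UNIV = infsum f UNIV"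
  by (rule infsum_reindex_bij_betw) (rule bij_int_reflect)

lemma summable_on_int_shift: "(\<lambda>m. f (m + (c::int))) summable_on UNIV \<longleftrightarrow> f summable_on UNIV"
  by (rule summable_on_reindex_bij_betw) (rule bij_int_shift)

lemma summable_on_int_reflect: "(\<lambda>m. f ((c::int) - m)) summable_on UNIV \<longleftrightarrow> f summable_on UNIV"
  by (rule summable_on_reindex_bij_betw) (rule bij_int_reflect)

lemma summable_on_norm_le:
  fixes f :: "'i \<Rightarrow> 'a::banach"
  assumes "g summable_on A" "\<And>x. x \<in> A \<Longrightarrow> norm (f x) \<le> g x"
  shows "f summable_on A"
  by (rule abs_summable_summable, rule summable_on_comparison_test[OF assms]) auto

lemma norm_infsum_le_infsum:
  fixes f :: "'i \<Rightarrow> 'a::banach"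
  assumes "g summable_on A" "\<And>x. x \<in> A \<Longrightarrow> norm (f x) \<le> g x"
  shows "norm (infsum f A) \<le> infsum g A"
  using has_sum_infsum[OF summable_on_norm_le[OF assms]] has_sum_infsum[OF assms(1)] assms(2)
  by (rule norm_infsum_le)

lemma infsum_delta:
  fixes f :: "'i \<Rightarrow> 'a::{comm_monoid_add,t2_space}"
  shows "infsum (\<lambda>m. if m = n then f m else 0) UNIV = f n"
proof -
  have "infsum (\<lambda>m. if m = n then f m else 0) UNIV = infsum f {n}"
    by (rule infsum_cong_neutral) auto
  then show ?thesis
    by simp
qed

text \<open>On finite subsets this is the finite inequality for \<open>sqrt (a x)\<close> and
  \<open>sqrt (a x) * b x\<close>; the weight \<open>a\<close> will be a row of a decaying
  kernel.\<close>

lemma infsum_cauchy_schwarz: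
  fixes a b :: "'i \<Rightarrow> real"
  assumes a: "a summable_on A" "\<And>x. x \<in> A \<Longrightarrow> 0 \<le> a x"
    and ab: "(\<lambda>x. a x * b x) summable_on A" "\<And>x. x \<in> A \<Longrightarrow> 0 \<le> b x"
    and ab2: "(\<lambda>x. a x * (b x)\<^sup>2) summable_on A"
  shows "(infsum (\<lambda>x. a x * b x) A)\<^sup>2 \<le> infsum a A * infsum (\<lambda>x. a x * (b x)\<^sup>2) A"
proof -
  define S T where "S = infsum a A" and "T = infsum (\<lambda>x. a x * (b x)\<^sup>2) A"
  have ST: "0 \<le> S" "0 \<le> T"
    unfolding S_def T_def using a ab by (auto intro!: infsum_nonneg)
  have "infsum (\<lambda>x. a x * b x) A \<le> sqrt (S * T)"
  proof (rule infsum_le_finite_sums[OF ab(1)])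
    fix F assume F: "finite F" "F \<subseteq> A"
    have "(\<Sum>x\<in>F. a x * b x)\<^sup>2 = (\<Sum>x\<in>F. sqrt (a x) * (sqrt (a x) * b x))\<^sup>2"
      using a(2) F by (intro arg_cong[of _ _ "\<lambda>t. t\<^sup>2"] sum.cong) (auto simp: mult.assoc[symmetric])
    also have "\<dots> \<le> (\<Sum>x\<in>F. (sqrt (a x))\<^sup>2) * (\<Sum>x\<in>F. (sqrt (a x) * b x)\<^sup>2)"
      by (rule Cauchy_Schwarz_ineq_sum)
    also have "\<dots> = (\<Sum>x\<in>F. a x) * (\<Sum>x\<in>F. a x * (b x)\<^sup>2)"
      using a(2) F by (intro arg_cong2[of _ _ _ _ "(*)"] sum.cong) (auto simp: power_mult_distrib)
    also have "\<dots> \<le> S * T"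
      unfolding S_def T_def using F a ab ab2 \<open>0 \<le> S\<close>
      by (intro mult_mono finite_sum_le_infsum sum_nonneg infsum_nonneg) auto
    finally show "(\<Sum>x\<in>F. a x * b x) \<le> sqrt (S * T)"
      by (rule real_le_rsqrt)
  qed
  moreover have "0 \<le> infsum (\<lambda>x. a x * b x) A"
    using a ab by (intro infsum_nonneg) auto
  ultimately have "(infsum (\<lambda>x. a x * b x) A)\<^sup>2 \<le> (sqrt (S * T))\<^sup>2"
    by (intro power_mono)
  then show ?thesis
    using ST by (simp add: S_def T_def)
qed

section \<open>Boundedness on \<open>l2\<close> of operators with decaying kernels\<close>

lemma cmod_le_l2_norm:
  assumes "\<psi> \<in> l2"
  shows "cmod (\<psi> n) \<le> l2_norm \<psi>"
proof -
  have "(\<Sum>m\<in>{n}. (cmod (\<psi> m))\<^sup>2) \<le> (\<Sum>\<^sub>\<infinity>m. (cmod (\<psi> m))\<^sup>2)"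
    using assms by (intro finite_sum_le_infsum) (auto simp: l2_def)
  then show ?thesis
    unfolding l2_norm_def by (intro real_le_rsqrt) simp
qed

definition kernel_op :: "(int \<Rightarrow> int \<Rightarrow> complex) \<Rightarrow> (int \<Rightarrow> complex) \<Rightarrow> int \<Rightarrow> complex" where
  "kernel_op K \<psi> n = (\<Sum>\<^sub>\<infinity>m. K n m * \<psi> m)"

lemma kernel_row_summable:
  assumes \<theta>: "0 \<le> \<theta>" "\<theta> < 1" and K: "\<And>n m. cmod (K n m) \<le> D * decay \<theta> (n - m)"
    and \<psi>: "\<And>m. cmod (\<psi> m) \<le> B"
  shows "(\<lambda>m. K n m * \<psi> m) summable_on UNIV"
proof (rule summable_on_norm_le)
  show "(\<lambda>m. D * decay \<theta> (n - m) * B) summable_on UNIV"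
    by (intro summable_on_cmult_left summable_on_cmult_right)
      (subst summable_on_int_reflect, rule summable_on_decay[OF \<theta>])
  show "cmod (K n m * \<psi> m) \<le> D * decay \<theta> (n - m) * B" for m
    unfolding norm_mult by (rule mult_mono[OF K \<psi>]) (use order_trans[OF norm_ge_zero K] in auto)
qed

text \<open>Schur test: weighted Cauchy-Schwarz on each row, then an exchange of summations. All row
  sums and all column sums of the dominating kernel equal \<open>S\<close>.\<close>

lemma kernel_op_l2_bound:
  assumes \<theta>: "0 \<le> \<theta>" "\<theta> < 1" and K: "\<And>n m. cmod (K n m) \<le> D * decay \<theta> (n - m)"
    and \<psi>: "\<psi> \<in> l2"
  shows "kernel_op K \<psi> \<in> l2"
    and "l2_norm (kernel_op K \<psi>) \<le> D * (\<Sum>\<^sub>\<infinity>n. decay \<theta> n) * l2_norm \<psi>"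
proof -
  define S where "S = (\<Sum>\<^sub>\<infinity>n. decay \<theta> n)"
  define N where "N = (\<Sum>\<^sub>\<infinity>m. (cmod (\<psi> m))\<^sup>2)"
  have "0 \<le> D * decay \<theta> (0 - 0)"
    by (rule order_trans[OF norm_ge_zero K])
  then have "0 \<le> D"
    by (simp add: decay_def)
  have "0 \<le> S"
    unfolding S_def by (intro infsum_nonneg decay_nonneg \<theta>)
  have \<psi>2: "(\<lambda>m. (cmod (\<psi> m))\<^sup>2) summable_on UNIV"
    using \<psi> by (simp add: l2_def)
  note dec = summable_on_decay[OF \<theta>]
  have dec_row: "(\<lambda>m. decay \<theta> (n - m)) summable_on UNIV" for n
    using dec by (subst summable_on_int_reflect)
  have dec_col: "(\<lambda>n. decay \<theta> (n - m)) summable_on UNIV" for m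
    using dec summable_on_int_shift[of "decay \<theta>" "- m"] by simp
  have S_row: "(\<Sum>\<^sub>\<infinity>m. decay \<theta> (n - m)) = S" for n
    unfolding S_def by (rule infsum_int_reflect)
  have S_col: "(\<Sum>\<^sub>\<infinity>n. decay \<theta> (n - m)) = S" for m
    unfolding S_def using infsum_int_shift[of "decay \<theta>" "- m"] by simp
  let ?f = "\<lambda>n m. decay \<theta> (n - m) * (cmod (\<psi> m))\<^sup>2"
  \<comment> \<open>Summability over pairs is checked with \<open>n\<close> as inner index, where
    the column sums are explicit, and is transposed afterwards.\<close>
  have prod: "(\<lambda>(m, n). ?f n m) summable_on UNIV \<times> UNIV"
  proof (rule abs_summable_summable, 
      rule iffD2[OF Infinite_Sum.abs_summable_on_Sigma_iff], intro conjI ballI)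
    fix m
    show "(\<lambda>n. norm (case (m, n) of (m, n) \<Rightarrow> ?f n m)) summable_on UNIV"
      using \<theta> by (simp add: abs_mult decay_nonneg summable_on_cmult_left dec_col)
  next
    have "infsum (\<lambda>n. norm (case (m, n) of (m, n) \<Rightarrow> ?f n m)) UNIV = S * (cmod (\<psi> m))\<^sup>2" for m
      using \<theta> S_col[of m] by (simp add: abs_mult decay_nonneg infsum_cmult_left dec_col)
    then show "(\<lambda>m. norm (infsum (\<lambda>n. norm (case (m, n) of (m, n) \<Rightarrow> ?f n m)) UNIV)) summable_on UNIV"
      using \<psi>2 \<open>0 \<le> S\<close> by (simp add: abs_mult summable_on_cmult_right)
  qed
  then have prod': "(\<lambda>(n, m). ?f n m) summable_on UNIV \<times> UNIV"
    by (subst (asm) summable_on_swap) simp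
  have row: "?f n summable_on UNIV" for n
  proof (rule summable_on_comparison_test)
    show "(\<lambda>m. decay \<theta> (n - m) * (l2_norm \<psi>)\<^sup>2) summable_on UNIV"
      by (intro summable_on_cmult_left dec_row)
    show "?f n m \<le> decay \<theta> (n - m) * (l2_norm \<psi>)\<^sup>2" for m
      by (intro mult_left_mono power_mono cmod_le_l2_norm \<psi> decay_nonneg \<theta>) auto
  qed (use \<theta> in \<open>simp add: decay_nonneg\<close>)
  have outer: "(\<lambda>n. infsum (?f n) UNIV) summable_on UNIV"
    using summable_on_Sigma_banach[OF prod'] by simp
  have "(\<Sum>\<^sub>\<infinity>n. infsum (?f n) UNIV) = (\<Sum>\<^sub>\<infinity>m. \<Sum>\<^sub>\<infinity>n. ?f n m)"
    by (rule infsum_swap_banach) (rule prod')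
  also have "\<dots> = S * N"
    unfolding N_def by (simp add: infsum_cmult_left dec_col S_col infsum_cmult_right \<psi>2)
  finally have total: "(\<Sum>\<^sub>\<infinity>n. infsum (?f n) UNIV) = S * N" .
  have pointwise: "(cmod (kernel_op K \<psi> n))\<^sup>2 \<le> D\<^sup>2 * S * infsum (?f n) UNIV" for n
  proof -
    have row1: "(\<lambda>m. decay \<theta> (n - m) * cmod (\<psi> m)) summable_on UNIV"
    proof (rule summable_on_comparison_test)
      show "(\<lambda>m. decay \<theta> (n - m) * l2_norm \<psi>) summable_on UNIV"
        by (intro summable_on_cmult_left dec_row)
      show "decay \<theta> (n - m) * cmod (\<psi> m) \<le> decay \<theta> (n - m) * l2_norm \<psi>" for m
        by (intro mult_left_mono cmod_le_l2_norm \<psi> decay_nonneg \<theta>)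
    qed (use \<theta> in \<open>simp add: decay_nonneg\<close>)
    have "cmod (kernel_op K \<psi> n) \<le> (\<Sum>\<^sub>\<infinity>m. D * (decay \<theta> (n - m) * cmod (\<psi> m)))"
      unfolding kernel_op_def
    proof (rule norm_infsum_le_infsum)
      show "(\<lambda>m. D * (decay \<theta> (n - m) * cmod (\<psi> m))) summable_on UNIV"
        by (intro summable_on_cmult_right row1)
      show "cmod (K n m * \<psi> m) \<le> D * (decay \<theta> (n - m) * cmod (\<psi> m))" for m
        using mult_right_mono[OF K[of n m], of "cmod (\<psi> m)"] by (simp add: norm_mult mult.assoc)
    qed
    also have "\<dots> = D * (\<Sum>\<^sub>\<infinity>m. decay \<theta> (n - m) * cmod (\<psi> m))"
      by (intro infsum_cmult_right row1)
    finally have "(cmod (kernel_op K \<psi> n))\<^sup>2 \<le> D\<^sup>2 * (\<Sum>\<^sub>\<infinity>m. decay \<theta> (n - m) * cmod (\<psi> m))\<^sup>2"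
      unfolding power_mult_distrib [symmetric] by (intro power_mono) auto
    also have "\<dots> \<le> D\<^sup>2 * (infsum (\<lambda>m. decay \<theta> (n - m)) UNIV * infsum (?f n) UNIV)"
      by (intro mult_left_mono infsum_cauchy_schwarz dec_row row row1 decay_nonneg \<theta>) auto
    finally show ?thesis
      by (simp add: S_row mult.assoc)
  qed
  show l2: "kernel_op K \<psi> \<in> l2"
    unfolding l2_def mem_Collect_eq
    by (rule summable_on_comparison_test[OF summable_on_cmult_right[OF outer] pointwise]) auto
  have "(\<Sum>\<^sub>\<infinity>n. (cmod (kernel_op K \<psi> n))\<^sup>2) \<le> (\<Sum>\<^sub>\<infinity>n. D\<^sup>2 * S * infsum (?f n) UNIV)"
    using l2 by (intro infsum_mono pointwise summable_on_cmult_right outer) (simp add: l2_def)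
  also have "\<dots> = D\<^sup>2 * S * (S * N)"
    unfolding total [symmetric] by (intro infsum_cmult_right outer)
  also have "\<dots> = (D * S)\<^sup>2 * N"
    by (simp add: power2_eq_square)
  finally have "l2_norm (kernel_op K \<psi>) \<le> sqrt ((D * S)\<^sup>2 * N)"
    unfolding l2_norm_def by (rule real_sqrt_le_mono)
  also have "\<dots> = D * S * l2_norm \<psi>"
    using \<open>0 \<le> D\<close> \<open>0 \<le> S\<close> by (simp add: real_sqrt_mult l2_norm_def N_def)
  finally show "l2_norm (kernel_op K \<psi>) \<le> D * (\<Sum>\<^sub>\<infinity>n. decay \<theta> n) * l2_norm \<psi>"
    by (simp add: S_def)
qed

lemma l2_bounded_linear_kernel_op:
  assumes \<theta>: "0 \<le> \<theta>" "\<theta> < 1" and K: "\<And>n m. cmod (K n m) \<le> D * decay \<theta> (n - m)"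
  shows "l2_bounded_linear (kernel_op K)"
proof -
  have row: "(\<lambda>m. K n m * \<psi> m) summable_on UNIV" if "\<psi> \<in> l2" for n \<psi>
    using kernel_row_summable[OF assms cmod_le_l2_norm[OF that]] .
  show ?thesis
    unfolding l2_bounded_linear_def
  proof (intro conjI ballI allI)
    fix \<psi> \<phi> assume "\<psi> \<in> l2" "\<phi> \<in> l2"
    then show "kernel_op K (\<lambda>n. \<psi> n + \<phi> n) = (\<lambda>n. kernel_op K \<psi> n + kernel_op K \<phi> n)"
      by (intro ext) (simp add: kernel_op_def distrib_left infsum_add row)
  next
    fix c \<psi> assume "\<psi> \<in> l2"
    then show "kernel_op K (\<lambda>n. c * \<psi> n) = (\<lambda>n. c * kernel_op K \<psi> n)"
      by (intro ext) (simp add: kernel_op_def mult.left_commute[of _ c] infsum_cmult_right row)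
  next
    show "\<exists>C. \<forall>\<psi>\<in>l2. l2_norm (kernel_op K \<psi>) \<le> C * l2_norm \<psi>"
      using kernel_op_l2_bound(2)[OF assms] by blast
  qed (rule kernel_op_l2_bound(1)[OF assms])
qed

section \<open>Inversion of Schroedinger operators on \<open>l2\<close> through a Green
  kernel\<close>

lemma l2_shift: "\<psi> \<in> l2 \<Longrightarrow> (\<lambda>n. \<psi> (n + c)) \<in> l2"
  unfolding l2_def mem_Collect_eq
  by (subst summable_on_int_shift[of "\<lambda>n. (cmod (\<psi> n))\<^sup>2"])

lemma l2_add:
  assumes "\<psi> \<in> l2" "\<phi> \<in> l2"
  shows "(\<lambda>n. \<psi> n + \<phi> n) \<in> l2"
  unfolding l2_def mem_Collect_eq
proof (rule summable_on_comparison_test)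
  show "(\<lambda>n. 2 * (cmod (\<psi> n))\<^sup>2 + 2 * (cmod (\<phi> n))\<^sup>2) summable_on UNIV"
    using assms by (intro summable_on_add summable_on_cmult_right) (auto simp: l2_def)
  show "(cmod (\<psi> n + \<phi> n))\<^sup>2 \<le> 2 * (cmod (\<psi> n))\<^sup>2 + 2 * (cmod (\<phi> n))\<^sup>2" for n
  proof -
    have "(cmod (\<psi> n + \<phi> n))\<^sup>2 \<le> (cmod (\<psi> n) + cmod (\<phi> n))\<^sup>2"
      by (intro power_mono norm_triangle_ineq) auto
    also have "\<dots> \<le> 2 * (cmod (\<psi> n))\<^sup>2 + 2 * (cmod (\<phi> n))\<^sup>2"
      using sum_squares_bound[of "cmod (\<psi> n)" "cmod (\<phi> n)"] by (simp add: power2_sum)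
    finally show ?thesis .
  qed
qed auto

lemma l2_bounded_mult:
  assumes "\<psi> \<in> l2" "\<And>n. cmod (v n) \<le> B"
  shows "(\<lambda>n. v n * \<psi> n) \<in> l2"
  unfolding l2_def mem_Collect_eq
proof (rule summable_on_comparison_test)
  show "(\<lambda>n. B\<^sup>2 * (cmod (\<psi> n))\<^sup>2) summable_on UNIV"
    using assms(1) by (intro summable_on_cmult_right) (auto simp: l2_def)
  show "(cmod (v n * \<psi> n))\<^sup>2 \<le> B\<^sup>2 * (cmod (\<psi> n))\<^sup>2" for n
    using assms(2)[of n] by (simp add: norm_mult power_mult_distrib mult_right_mono power_mono)
qed auto

text \<open>The Green kernel of a Schroedinger operator is a right inverse by its defining equation, and
  its transpose is a left inverse by summation by parts; hence the two coincide.\<close>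

lemma kernel_op_resolvent:
  assumes \<theta>: "0 \<le> \<theta>" "\<theta> < 1" and G: "\<And>n m. cmod (G n m) \<le> D * decay \<theta> (n - m)"
    and v: "\<And>n. cmod (v n) \<le> B"
    and green: "\<And>n m. G (n + 1) m + G (n - 1) m + v n * G n m = (if n = m then 1 else 0)"
  shows "\<forall>\<psi>\<in>l2. kernel_op G (\<lambda>n. \<psi> (n + 1) + \<psi> (n - 1) + v n * \<psi> n) = \<psi>"
    and "\<forall>\<psi>\<in>l2. (\<lambda>n. kernel_op G \<psi> (n + 1) + kernel_op G \<psi> (n - 1) + v n * kernel_op G \<psi> n) = \<psi>"
proof -
  define A where "A = (\<lambda>(\<psi> :: int \<Rightarrow> complex) n. \<psi> (n + 1) + \<psi> (n - 1) + v n * \<psi> n)"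
  define G' where "G' = (\<lambda>n m. G m n)"
  have G': "cmod (G' n m) \<le> D * decay \<theta> (n - m)" for n m
    using G[of m n] decay_minus[of \<theta> "n - m"] by (simp add: G'_def)
  have A_l2: "A \<psi> \<in> l2" if "\<psi> \<in> l2" for \<psi>
    unfolding A_def using l2_shift[OF that, of 1] l2_shift[OF that, of "-1"]
    by (intro l2_add l2_bounded_mult[OF that v]) auto
  have row: "(\<lambda>m. G n m * \<psi> m) summable_on UNIV" if "\<psi> \<in> l2" for n \<psi>
    using kernel_row_summable[OF \<theta> G cmod_le_l2_norm[OF that]] .
  have right: "A (kernel_op G \<psi>) = \<psi>" if \<psi>: "\<psi> \<in> l2" for \<psi>
  proof
    fix n
    have "A (kernel_op G \<psi>) n
      = (\<Sum>\<^sub>\<infinity>m. G (n + 1) m * \<psi> m + G (n - 1) m * \<psi> m + v n * (G n m * \<psi> m))"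
      unfolding A_def kernel_op_def
      by (simp add: infsum_add summable_on_add infsum_cmult_right summable_on_cmult_right row[OF \<psi>])
    also have "\<dots> = (\<Sum>\<^sub>\<infinity>m. if m = n then \<psi> m else 0)"
    proof (rule infsum_cong)
      fix m
      have "G (n + 1) m * \<psi> m + G (n - 1) m * \<psi> m + v n * (G n m * \<psi> m)
        = (G (n + 1) m + G (n - 1) m + v n * G n m) * \<psi> m"
        by (simp add: algebra_simps)
      then show "G (n + 1) m * \<psi> m + G (n - 1) m * \<psi> m + v n * (G n m * \<psi> m)
        = (if m = n then \<psi> m else 0)"
        by (simp add: green)
    qed
    also have "\<dots> = \<psi> n"
      by (rule infsum_delta)
    finally show "A (kernel_op G \<psi>) n = \<psi> n" .
  qed
  have left: "kernel_op G' (A \<psi>) = \<psi>" if \<psi>: "\<psi> \<in> l2" for \<psi>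
  proof
    fix n
    have row': "(\<lambda>m. G m n * \<phi> m) summable_on UNIV" if "\<phi> \<in> l2" for \<phi>
      using kernel_row_summable[OF \<theta> G' cmod_le_l2_norm[OF that]] by (simp add: G'_def)
    have v\<psi>: "(\<lambda>m. v m * \<psi> m) \<in> l2"
      by (rule l2_bounded_mult[OF \<psi> v])
    have p1: "(\<lambda>m. G m n * \<psi> (m + 1)) summable_on UNIV"
      using row'[OF l2_shift[OF \<psi>, of 1]] .
    have p2: "(\<lambda>m. G m n * \<psi> (m - 1)) summable_on UNIV"
      using row'[OF l2_shift[OF \<psi>, of "-1"]] by simp
    have p3: "(\<lambda>m. v m * G m n * \<psi> m) summable_on UNIV"
      using row'[OF v\<psi>] by (simp add: mult_ac)
    have q1: "(\<lambda>m. G (m - 1) n * \<psi> m) summable_on UNIV"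
      using p1 summable_on_int_shift[of "\<lambda>m. G (m - 1) n * \<psi> m" 1] by simp
    have q2: "(\<lambda>m. G (m + 1) n * \<psi> m) summable_on UNIV"
      using p2 summable_on_int_shift[of "\<lambda>m. G (m + 1) n * \<psi> m" "-1"] by simp
    have "kernel_op G' (A \<psi>) n
      = (\<Sum>\<^sub>\<infinity>m. G m n * \<psi> (m + 1) + G m n * \<psi> (m - 1) + v m * G m n * \<psi> m)"
      unfolding kernel_op_def G'_def A_def by (intro infsum_cong) (simp add: algebra_simps)
    also have "\<dots> = (\<Sum>\<^sub>\<infinity>m. G m n * \<psi> (m + 1)) + (\<Sum>\<^sub>\<infinity>m. G m n * \<psi> (m - 1))
        + (\<Sum>\<^sub>\<infinity>m. v m * G m n * \<psi> m)"
      using p1 p2 p3 by (simp add: infsum_add summable_on_add)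
    also have "(\<Sum>\<^sub>\<infinity>m. G m n * \<psi> (m + 1)) = (\<Sum>\<^sub>\<infinity>m. G (m - 1) n * \<psi> m)"
      using infsum_int_shift[of "\<lambda>m. G (m - 1) n * \<psi> m" 1] by simp
    also have "(\<Sum>\<^sub>\<infinity>m. G m n * \<psi> (m - 1)) = (\<Sum>\<^sub>\<infinity>m. G (m + 1) n * \<psi> m)"
      using infsum_int_shift[of "\<lambda>m. G (m + 1) n * \<psi> m" "-1"] by simp
    also have "(\<Sum>\<^sub>\<infinity>m. G (m - 1) n * \<psi> m) + (\<Sum>\<^sub>\<infinity>m. G (m + 1) n * \<psi> m) + (\<Sum>\<^sub>\<infinity>m. v m * G m n * \<psi> m)
        = (\<Sum>\<^sub>\<infinity>m. G (m - 1) n * \<psi> m + G (m + 1) n * \<psi> m + v m * G m n * \<psi> m)"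
      using q1 q2 p3 by (simp add: infsum_add summable_on_add)
    also have "\<dots> = (\<Sum>\<^sub>\<infinity>m. if m = n then \<psi> m else 0)"
    proof (rule infsum_cong)
      fix m
      have "G (m - 1) n * \<psi> m + G (m + 1) n * \<psi> m + v m * G m n * \<psi> m
        = (G (m + 1) n + G (m - 1) n + v m * G m n) * \<psi> m"
        by (simp add: algebra_simps)
      then show "G (m - 1) n * \<psi> m + G (m + 1) n * \<psi> m + v m * G m n * \<psi> m
        = (if m = n then \<psi> m else 0)"
        by (simp add: green)
    qed
    also have "\<dots> = \<psi> n"
      by (rule infsum_delta)
    finally show "kernel_op G' (A \<psi>) n = \<psi> n" .
  qed
  have eq: "kernel_op G \<psi> = kernel_op G' \<psi>" if "\<psi> \<in> l2" for \<psi>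
    using left[OF kernel_op_l2_bound(1)[OF \<theta> G that]] right[OF that] by simp
  show "\<forall>\<psi>\<in>l2. kernel_op G (\<lambda>n. \<psi> (n + 1) + \<psi> (n - 1) + v n * \<psi> n) = \<psi>"
    using eq[OF A_l2] left by (simp add: A_def)
  show "\<forall>\<psi>\<in>l2. (\<lambda>n. kernel_op G \<psi> (n + 1) + kernel_op G \<psi> (n - 1) + v n * kernel_op G \<psi> n) = \<psi>"
    using right by (simp add: A_def)
qed

lemma not_in_l2_spectrum_exp_operator:
  assumes "0 \<le> \<theta>" "\<theta> < 1" and G: "\<And>n m. cmod (G n m) \<le> D * decay \<theta> (n - m)"
    and green: "\<And>n m. G (n + 1) m + G (n - 1) m
      + (of_real lam * cis (x + of_int n * \<alpha>) - E) * G n m = (if n = m then 1 else 0)"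
  shows "E \<notin> l2_spectrum (exp_operator lam \<alpha> x)"
proof -
  have v: "cmod (of_real lam * cis (x + of_int n * \<alpha>) - E) \<le> \<bar>lam\<bar> + cmod E" for n
    by (rule order_trans[OF norm_triangle_ineq4]) (simp add: norm_mult)
  have op: "exp_operator lam \<alpha> x \<psi> n - E * \<psi> n
    = \<psi> (n + 1) + \<psi> (n - 1) + (of_real lam * cis (x + of_int n * \<alpha>) - E) * \<psi> n" for \<psi> n
    by (simp add: exp_operator_def algebra_simps)
  show ?thesis
    unfolding l2_spectrum_def mem_Collect_eq not_not op
    using l2_bounded_linear_kernel_op[OF assms(1-3)] kernel_op_resolvent[OF assms(1-3) v green]
    by blast
qed

section \<open>The Green kernel outside the spectrum\<close>

text \<open>Coefficients of \<open>\<Prod>j\<le>k. 1 / (1 - q\<^sup>j u X)\<close>, extended by zero to negative indices.\<close>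

definition jost :: "complex \<Rightarrow> nat \<Rightarrow> complex \<Rightarrow> int \<Rightarrow> complex" where
  "jost q k u a = (if 0 \<le> a then qbinom q (k + nat a) (nat a) * u ^ nat a else 0)"

lemma jost_0_diff: "jost q 0 u a - u * jost q 0 u (a - 1) = (if a = 0 then 1 else 0)"
proof (cases "a \<le> 0")
  case False
  then have "a = int (Suc (nat (a - 1)))"
    by simp
  then obtain m where m: "a = int (Suc m)"
    by blast
  then have "nat a = Suc m" "nat (a - 1) = m"
    by auto
  then show ?thesis
    using m by (simp add: jost_def)
qed (simp add: jost_def)

text \<open>Coefficient form of \<open>qbinom_fps_Suc\<close>, with the dilation written as the
  factor \<open>q powi a\<close>. For negative \<open>a\<close> both sides vanish and at 0 both are
  1.\<close>

lemma jost_Suc_diff: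
  assumes "q \<noteq> 0"
  shows "jost q (Suc k) u a - u * jost q (Suc k) u (a - 1) = q powi a * jost q k u a"
proof (cases "a \<le> 0")
  case False
  then have "a = int (Suc (nat (a - 1)))"
    by simp
  then obtain m where m: "a = int (Suc m)"
    by blast
  then have nat_a: "nat a = Suc m" "nat (a - 1) = m"
    by auto
  have "q powi a = q ^ Suc m"
    unfolding m by (rule power_int_of_nat)
  then show ?thesis
    using False by (simp add: jost_def nat_a) (simp add: algebra_simps)
qed (simp add: jost_def)

text \<open>The growth in \<open>k\<close> becomes a prefactor, to be absorbed by the Neumann
  series, while the growth in \<open>a\<close> enters the decay rate.\<close>

lemma norm_jost_le:
  assumes B: "\<And>n k. cmod (qbinom q n k) \<le> C * exp (\<epsilon> * n)" and "C > 0"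
  shows "cmod (jost q k u a) \<le> C * exp (\<epsilon> * k) * decay (exp \<epsilon> * cmod u) a"
proof (cases "0 \<le> a")
  case True
  then obtain m where m: "a = int m"
    using nonneg_int_cases by blast
  have "cmod (jost q k u a) \<le> C * exp (\<epsilon> * (k + m)) * cmod u ^ m"
    using B[of "k + m" m] by (simp add: jost_def m norm_mult norm_power mult_right_mono)
  also have "\<dots> = C * exp (\<epsilon> * k) * (exp (m * \<epsilon>) * cmod u ^ m)"
    by (simp add: algebra_simps exp_add)
  also have "\<dots> = C * exp (\<epsilon> * k) * decay (exp \<epsilon> * cmod u) a"
    by (simp add: decay_def m power_mult_distrib exp_of_nat_mult)
  finally show ?thesis .
qed (use \<open>C > 0\<close> in \<open>simp add: jost_def decay_def\<close>)

text \<open>Both \<open>\<bar>n\<bar>\<close> and \<open>\<bar>b\<bar>\<close> are at most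
  \<open>\<bar>n + b\<bar> + \<bar>b\<bar>\<close>. The squared rate thus leaves one decaying factor
  for the summation over \<open>b\<close> and one for the decay in \<open>n\<close>.\<close>

lemma decay_convolution_le:
  assumes "0 \<le> \<theta>" "\<theta> \<le> 1"
  shows "decay (\<theta>\<^sup>2) (n + b) * decay (\<theta>\<^sup>2) b \<le> decay \<theta> n * decay \<theta> b"
proof -
  have "decay (\<theta>\<^sup>2) (n + b) * decay (\<theta>\<^sup>2) b = \<theta> ^ (2 * (nat \<bar>n + b\<bar> + nat \<bar>b\<bar>))"
    by (simp add: decay_def power_add algebra_simps flip: power_mult)
  also have "\<dots> \<le> \<theta> ^ (nat \<bar>n\<bar> + nat \<bar>b\<bar>)"
    using assms by (intro power_decreasing) auto
  also have "\<dots> = decay \<theta> n * decay \<theta> b"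
    by (simp add: decay_def power_add)
  finally show ?thesis .
qed

lemma summable_on_convolution_decay:
  fixes P Q :: "int \<Rightarrow> complex"
  assumes \<theta>: "0 \<le> \<theta>" "\<theta> < 1"
    and P: "\<And>a. cmod (P a) \<le> A * decay (\<theta>\<^sup>2) a" and Q: "\<And>a. cmod (Q a) \<le> A * decay (\<theta>\<^sup>2) a"
  shows "(\<lambda>b. P (n + b) * Q b) summable_on UNIV"
    and "cmod (\<Sum>\<^sub>\<infinity>b. P (n + b) * Q b) \<le> A\<^sup>2 * (\<Sum>\<^sub>\<infinity>b. decay \<theta> b) * decay \<theta> n"
proof -
  have "0 \<le> A * decay (\<theta>\<^sup>2) 0"
    by (rule order_trans[OF norm_ge_zero P])
  then have "0 \<le> A"
    by (simp add: decay_def)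
  have le: "cmod (P (n + b) * Q b) \<le> A\<^sup>2 * decay \<theta> n * decay \<theta> b" for b
  proof -
    have "cmod (P (n + b) * Q b) \<le> (A * decay (\<theta>\<^sup>2) (n + b)) * (A * decay (\<theta>\<^sup>2) b)"
      unfolding norm_mult by (intro mult_mono P Q mult_nonneg_nonneg decay_nonneg) (use \<open>0 \<le> A\<close> in auto)
    also have "\<dots> = A\<^sup>2 * (decay (\<theta>\<^sup>2) (n + b) * decay (\<theta>\<^sup>2) b)"
      by (simp add: power2_eq_square)
    also have "\<dots> \<le> A\<^sup>2 * (decay \<theta> n * decay \<theta> b)"
      using \<theta> by (intro mult_left_mono decay_convolution_le) auto
    finally show ?thesis
      by (simp add: mult.assoc)
  qed
  have dom: "(\<lambda>b. A\<^sup>2 * decay \<theta> n * decay \<theta> b) summable_on UNIV"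
    by (intro summable_on_cmult_right summable_on_decay \<theta>)
  show "(\<lambda>b. P (n + b) * Q b) summable_on UNIV"
    by (rule summable_on_norm_le[OF dom le])
  have "cmod (\<Sum>\<^sub>\<infinity>b. P (n + b) * Q b) \<le> (\<Sum>\<^sub>\<infinity>b. A\<^sup>2 * decay \<theta> n * decay \<theta> b)"
    by (rule norm_infsum_le_infsum[OF dom le])
  also have "\<dots> = A\<^sup>2 * decay \<theta> n * (\<Sum>\<^sub>\<infinity>b. decay \<theta> b)"
    by (intro infsum_cmult_right summable_on_decay \<theta>)
  finally show "cmod (\<Sum>\<^sub>\<infinity>b. P (n + b) * Q b) \<le> A\<^sup>2 * (\<Sum>\<^sub>\<infinity>b. decay \<theta> b) * decay \<theta> n"
    by (simp add: mult_ac)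
qed

text \<open>The free operator factors as \<open>E - S - S\<^sup>-\<^sup>1 = w (1 - u S) (1 - u S\<^sup>-\<^sup>1)\<close> with \<open>S\<close> the
  shift and \<open>u = 1/w\<close>.\<close>

lemma convolution_laplacian:
  fixes P Q :: "int \<Rightarrow> complex"
  assumes sum: "\<And>n. (\<lambda>b. P (n + b) * Q b) summable_on UNIV" and "w \<noteq> 0" and u: "u = inverse w"
  defines "c \<equiv> \<lambda>n. \<Sum>\<^sub>\<infinity>b. P (n + b) * Q b"
  shows "(w + u) * c n - c (n + 1) - c (n - 1)
    = w * (\<Sum>\<^sub>\<infinity>b. (P (n + b) - u * P (n + b - 1)) * (Q b - u * Q (b - 1)))"
proof -
  have s1: "(\<lambda>b. P (n + b) * Q (b - 1)) summable_on UNIV"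
    using sum[of "n + 1"] summable_on_int_shift[of "\<lambda>b. P (n + b) * Q (b - 1)" 1] by (simp add: ac_simps)
  have c1: "c (n + 1) = (\<Sum>\<^sub>\<infinity>b. P (n + b) * Q (b - 1))"
    unfolding c_def using infsum_int_shift[of "\<lambda>b. P (n + b) * Q (b - 1)" 1] by (simp add: ac_simps)
  have s2: "(\<lambda>b. P (n + b - 1) * Q b) summable_on UNIV"
    using sum[of "n - 1"] by (simp add: algebra_simps)
  have c2: "c (n - 1) = (\<Sum>\<^sub>\<infinity>b. P (n + b - 1) * Q b)"
    unfolding c_def by (simp add: algebra_simps)
  have s3: "(\<lambda>b. P (n + b - 1) * Q (b - 1)) summable_on UNIV"
    using sum[of n] summable_on_int_shift[of "\<lambda>b. P (n + b - 1) * Q (b - 1)" 1] by simp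
  have c3: "c n = (\<Sum>\<^sub>\<infinity>b. P (n + b - 1) * Q (b - 1))"
    unfolding c_def using infsum_int_shift[of "\<lambda>b. P (n + b - 1) * Q (b - 1)" 1] by simp
  have wu: "w * u = 1"
    using assms by simp
  have "(\<Sum>\<^sub>\<infinity>b. (P (n + b) - u * P (n + b - 1)) * (Q b - u * Q (b - 1)))
    = (\<Sum>\<^sub>\<infinity>b. P (n + b) * Q b + u\<^sup>2 * (P (n + b - 1) * Q (b - 1))
        + (- u) * (P (n + b) * Q (b - 1)) + (- u) * (P (n + b - 1) * Q b))"
    by (intro infsum_cong) (simp add: algebra_simps power2_eq_square)
  also have "\<dots> = c n + u\<^sup>2 * (\<Sum>\<^sub>\<infinity>b. P (n + b - 1) * Q (b - 1))
      + (- u) * (\<Sum>\<^sub>\<infinity>b. P (n + b) * Q (b - 1)) + (- u) * (\<Sum>\<^sub>\<infinity>b. P (n + b - 1) * Q b)"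
    unfolding c_def
    by (simp only: infsum_add summable_on_add infsum_cmult_right summable_on_cmult_right sum[of n] s1 s2 s3)
  also have "w * \<dots> = (w * c n + (w * u) * u * c n) - ((w * u) * c (n + 1) + (w * u) * c (n - 1))"
    unfolding c1 [symmetric] c2 [symmetric] c3 [symmetric]
    by (simp add: algebra_simps power2_eq_square)
  finally show ?thesis
    unfolding wu by (simp add: algebra_simps)
qed

text \<open>Convolution kernel of the \<open>k\<close>-th term of the Neumann series: its symbol is the product over
  \<open>j \<le> k\<close> of \<open>1 / (E - 2 cos (\<theta> + j \<alpha>))\<close>, and each factor splits into two geometric series.\<close>

definition neumann_kernel :: "complex \<Rightarrow> complex \<Rightarrow> nat \<Rightarrow> int \<Rightarrow> complex" where
  "neumann_kernel q u k n = u ^ Suc k * (\<Sum>\<^sub>\<infinity>b. jost q k u (n + b) * jost (inverse q) k u b)"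

lemma exp_operator_resolvent_point:
  assumes irr: "\<alpha> / (2 * pi) \<notin> \<rat>" and "lam \<noteq> 0" and w: "cmod w > 1" "cmod w > \<bar>lam\<bar>"
    and E: "E = w + inverse w"
  shows "E \<notin> l2_spectrum (exp_operator lam \<alpha> x)"
proof -
  define q where "q = cis \<alpha>"
  define u where "u = inverse w"
  define \<mu> where "\<mu> = of_real lam * cis x"
  have q: "cmod q = 1" "q \<noteq> 0" "inverse q = cnj q"
    by (simp_all add: q_def cis_cnj cis_inverse)
  have w0: "w \<noteq> 0"
    using w by auto
  \<comment> \<open>Here \<open>t\<close> bounds both the spatial decay rate and the ratio of the
    Neumann series; \<epsilon> is then chosen so that \<open>exp (2 * \<epsilon>) * t\<close> equals
    the square root of \<open>t\<close>.\<close>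
  define t where "t = max (cmod u) (\<bar>lam\<bar> * cmod u)"
  have u0: "0 < cmod u"
    using w0 by (simp add: u_def)
  have "cmod u < 1" "\<bar>lam\<bar> * cmod u < 1"
    using w w0 by (simp_all add: u_def norm_divide divide_simps)
  then have t: "0 < t" "t < 1"
    using u0 by (auto simp: t_def less_max_iff_disj)
  define \<epsilon> where "\<epsilon> = - ln t / 4"
  have \<epsilon>: "\<epsilon> > 0"
    using t by (simp add: \<epsilon>_def)
  have "exp (2 * \<epsilon>) * t = exp (2 * \<epsilon> + ln t)"
    using t by (simp add: exp_add)
  also have "\<dots> < 1"
    using t by (simp add: \<epsilon>_def)
  finally have small: "exp (2 * \<epsilon>) * t < 1" .
  \<comment> \<open>Ratio of the Neumann series; each of the two \<open>jost\<close> factors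
    contributes \<open>exp (\<epsilon> * k)\<close> to its \<open>k\<close>-th term.\<close>
  define \<rho> where "\<rho> = exp (2 * \<epsilon>) * (\<bar>lam\<bar> * cmod u)"
  have "\<rho> \<le> exp (2 * \<epsilon>) * t"
    unfolding \<rho>_def by (intro mult_left_mono) (auto simp: t_def)
  then have \<rho>: "\<rho> < 1"
    using small by linarith
  have \<rho>0: "0 \<le> \<rho>"
    by (simp add: \<rho>_def)
  \<comment> \<open>The square root is the loss of rate in
    \<open>decay_convolution_le\<close>.\<close>
  define \<theta> where "\<theta> = sqrt (exp \<epsilon> * cmod u)"
  have \<theta>2: "\<theta>\<^sup>2 = exp \<epsilon> * cmod u"
    by (simp add: \<theta>_def)
  have "exp \<epsilon> * cmod u \<le> exp (2 * \<epsilon>) * t"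
    using \<epsilon> by (intro mult_mono) (auto simp: t_def)
  then have "exp \<epsilon> * cmod u < 1"
    using small by linarith
  then have \<theta>: "0 \<le> \<theta>" "\<theta> < 1"
    by (auto simp: \<theta>_def)
  obtain C where C: "C > 0" "\<And>n k. cmod (qbinom q n k) \<le> C * exp (\<epsilon> * n)"
    using norm_qbinom_subexponential[of q \<epsilon>] cis_power_neq_1[OF irr] q \<epsilon> by (auto simp: q_def)
  have C': "cmod (qbinom (inverse q) n k) \<le> C * exp (\<epsilon> * n)" for n k
    using C(2)[of n k] unfolding q(3) cnj_qbinom [symmetric] by simp
  have P: "cmod (jost q k u a) \<le> C * exp (\<epsilon> * k) * decay (\<theta>\<^sup>2) a" for k a
    unfolding \<theta>2 by (rule norm_jost_le[OF C(2,1)])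
  have Q: "cmod (jost (inverse q) k u a) \<le> C * exp (\<epsilon> * k) * decay (\<theta>\<^sup>2) a" for k a
    unfolding \<theta>2 by (rule norm_jost_le[OF C' C(1)])
  define S where "S = (\<Sum>\<^sub>\<infinity>b. decay \<theta> b)"
  define h where "h = neumann_kernel q u"
  note conv = summable_on_convolution_decay[OF \<theta> P Q]
  have h_norm: "cmod (h k n) \<le> cmod u ^ Suc k * ((C * exp (\<epsilon> * k))\<^sup>2 * S * decay \<theta> n)" for k n
    unfolding h_def neumann_kernel_def norm_mult norm_power S_def
    by (intro mult_left_mono conv) auto
  have h_0: "E * h 0 n - h 0 (n + 1) - h 0 (n - 1) = (if n = 0 then 1 else 0)" for n
  proof -
    have "E * h 0 n - h 0 (n + 1) - h 0 (n - 1)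
      = u * (w * (\<Sum>\<^sub>\<infinity>b. (jost q 0 u (n + b) - u * jost q 0 u (n + b - 1))
          * (jost (inverse q) 0 u b - u * jost (inverse q) 0 u (b - 1))))"
      unfolding convolution_laplacian[OF conv(1) w0 u_def, symmetric]
      by (simp add: h_def neumann_kernel_def E u_def algebra_simps)
    also have "(\<Sum>\<^sub>\<infinity>b. (jost q 0 u (n + b) - u * jost q 0 u (n + b - 1))
          * (jost (inverse q) 0 u b - u * jost (inverse q) 0 u (b - 1)))
      = (\<Sum>\<^sub>\<infinity>b::int. if b = 0 then (if n = 0 then 1 else 0) else 0)"
      unfolding jost_0_diff by (rule infsum_cong) simp
    also have "(\<Sum>\<^sub>\<infinity>b::int. if b = 0 then (if n = 0 then 1 else 0) else 0) = (if n = 0 then 1 else 0 :: complex)"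
      by (rule infsum_delta)
    also have "u * (w * (if n = 0 then 1 else 0)) = (if n = 0 then 1 else 0)"
      using w0 by (simp add: u_def)
    finally show ?thesis .
  qed
  have h_Suc: "E * h (Suc k) n - h (Suc k) (n + 1) - h (Suc k) (n - 1) = q powi n * h k n" for k n
  proof -
    have "E * h (Suc k) n - h (Suc k) (n + 1) - h (Suc k) (n - 1)
      = u ^ Suc (Suc k) * (w * (\<Sum>\<^sub>\<infinity>b. (jost q (Suc k) u (n + b) - u * jost q (Suc k) u (n + b - 1))
          * (jost (inverse q) (Suc k) u b - u * jost (inverse q) (Suc k) u (b - 1))))"
      unfolding convolution_laplacian[OF conv(1) w0 u_def, symmetric]
      by (simp add: h_def neumann_kernel_def E u_def algebra_simps)
    also have "(\<Sum>\<^sub>\<infinity>b. (jost q (Suc k) u (n + b) - u * jost q (Suc k) u (n + b - 1))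
          * (jost (inverse q) (Suc k) u b - u * jost (inverse q) (Suc k) u (b - 1)))
      = (\<Sum>\<^sub>\<infinity>b. q powi n * (jost q k u (n + b) * jost (inverse q) k u b))"
    proof (rule infsum_cong)
      fix b
      have "inverse q \<noteq> 0"
        using q by simp
      \<comment> \<open>Pairing \<open>q\<close> with \<open>inverse q\<close> makes the combined
        phase independent of the summation index \<open>b\<close>.\<close>
      have "q powi (n + b) * inverse q powi b = q powi n"
        using \<open>q \<noteq> 0\<close> by (simp add: power_int_add power_int_inverse)
      then show "(jost q (Suc k) u (n + b) - u * jost q (Suc k) u (n + b - 1))
          * (jost (inverse q) (Suc k) u b - u * jost (inverse q) (Suc k) u (b - 1))
        = q powi n * (jost q k u (n + b) * jost (inverse q) k u b)"
        unfolding jost_Suc_diff[OF \<open>q \<noteq> 0\<close>] jost_Suc_diff[OF \<open>inverse q \<noteq> 0\<close>]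
        by (metis (no_types, opaque_lifting) mult.assoc mult.commute)
    qed
    also have "\<dots> = q powi n * (\<Sum>\<^sub>\<infinity>b. jost q k u (n + b) * jost (inverse q) k u b)"
      by (intro infsum_cmult_right conv)
    also have "u ^ Suc (Suc k) * (w * (q powi n * (\<Sum>\<^sub>\<infinity>b. jost q k u (n + b) * jost (inverse q) k u b)))
      = (u * w) * (q powi n * h k n)"
      by (simp add: h_def neumann_kernel_def)
    finally show ?thesis
      using w0 by (simp add: u_def)
  qed
  \<comment> \<open>Kernel of the \<open>k\<close>-th Neumann term: collecting the phases of the
    \<open>k\<close> potential factors at the source site \<open>m\<close> leaves a convolution in
    \<open>n - m\<close>.\<close>
  define g where "g = (\<lambda>k n m. \<mu> ^ k * q powi (int k * m) * h k (n - m))"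
  define D where "D = cmod u * C\<^sup>2 * S"
  have g_norm: "cmod (g k n m) \<le> D * decay \<theta> (n - m) * \<rho> ^ k" for k n m
  proof -
    have "cmod (g k n m) = \<bar>lam\<bar> ^ k * cmod (h k (n - m))"
      using q by (simp add: g_def \<mu>_def norm_mult norm_power norm_power_int)
    also have "\<dots> \<le> \<bar>lam\<bar> ^ k * (cmod u ^ Suc k * ((C * exp (\<epsilon> * k))\<^sup>2 * S * decay \<theta> (n - m)))"
      by (intro mult_left_mono h_norm) auto
    also have "(C * exp (\<epsilon> * k))\<^sup>2 = C\<^sup>2 * exp (2 * \<epsilon>) ^ k"
      by (simp add: power_mult_distrib mult_ac flip: exp_of_nat_mult)
    also have "\<bar>lam\<bar> ^ k * (cmod u ^ Suc k * (C\<^sup>2 * exp (2 * \<epsilon>) ^ k * S * decay \<theta> (n - m)))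
      = D * decay \<theta> (n - m) * \<rho> ^ k"
      by (simp add: D_def \<rho>_def power_mult_distrib)
    finally show ?thesis .
  qed
  have geo: "summable (\<lambda>k. D * decay \<theta> (n - m) * \<rho> ^ k)" for n m
    using \<rho> \<rho>0 by (intro summable_mult summable_geometric) simp
  have g_sum: "summable (\<lambda>k. g k n m)" for n m
    by (rule summable_comparison_test'[OF geo g_norm])
  \<comment> \<open>The sign is reversed because the series inverts \<open>E - H\<close>, while
    \<open>l2_spectrum\<close> is defined through \<open>H - E\<close>.\<close>
  define G where "G = (\<lambda>n m. - (\<Sum>k. g k n m))"
  have G_norm: "cmod (G n m) \<le> D / (1 - \<rho>) * decay \<theta> (n - m)" for n m
  proof -
    have "cmod (G n m) \<le> (\<Sum>k. D * decay \<theta> (n - m) * \<rho> ^ k)"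
      unfolding G_def norm_minus_cancel by (rule norm_suminf_le[OF g_norm geo])
    also have "\<dots> = D / (1 - \<rho>) * decay \<theta> (n - m)"
      using \<rho> \<rho>0 by (simp add: suminf_mult suminf_geometric summable_geometric)
    finally show ?thesis .
  qed
  have g_0: "E * g 0 n m - g 0 (n + 1) m - g 0 (n - 1) m = (if n = m then 1 else 0)" for n m
    using h_0[of "n - m"] by (simp add: g_def algebra_simps)
  have g_Suc: "E * g (Suc k) n m - g (Suc k) (n + 1) m - g (Suc k) (n - 1) m
      = \<mu> * q powi n * g k n m" for k n m
  proof -
    have "E * g (Suc k) n m - g (Suc k) (n + 1) m - g (Suc k) (n - 1) m
      = \<mu> ^ Suc k * q powi (int (Suc k) * m)
        * (E * h (Suc k) (n - m) - h (Suc k) (n - m + 1) - h (Suc k) (n - m - 1))"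
      by (simp add: g_def algebra_simps)
    also have "\<dots> = \<mu> ^ Suc k * (q powi (int (Suc k) * m) * q powi (n - m)) * h k (n - m)"
      by (simp only: h_Suc mult_ac)
    also have "q powi (int (Suc k) * m) * q powi (n - m) = q powi n * q powi (int k * m)"
      using q(2) by (simp add: algebra_simps flip: power_int_add)
    finally show ?thesis
      by (simp add: g_def mult_ac)
  qed
  have green: "G (n + 1) m + G (n - 1) m + (of_real lam * cis (x + of_int n * \<alpha>) - E) * G n m
      = (if n = m then 1 else 0)" for n m
  proof -
    have v: "of_real lam * cis (x + of_int n * \<alpha>) = \<mu> * q powi n"
      by (simp add: \<mu>_def q_def cis_power_int flip: cis_mult)
    let ?L = "\<lambda>k. E * g k n m - g k (n + 1) m - g k (n - 1) m"
    have L_sum: "summable ?L"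
      by (intro summable_diff summable_mult g_sum)
    have "E * (\<Sum>k. g k n m) - (\<Sum>k. g k (n + 1) m) - (\<Sum>k. g k (n - 1) m) = suminf ?L"
      by (rule sums_unique) (intro sums_diff sums_mult summable_sums g_sum)
    \<comment> \<open>The free operator turns term \<open>k + 1\<close> into the potential times
      term \<open>k\<close>, so the series reproduces itself up to the delta from term 0.\<close>
    also have "\<dots> = ?L 0 + (\<Sum>k. ?L (Suc k))"
      using suminf_split_head[OF L_sum] by simp
    also have "(\<Sum>k. ?L (Suc k)) = \<mu> * q powi n * (\<Sum>k. g k n m)"
      unfolding g_Suc by (rule suminf_mult[OF g_sum])
    finally show ?thesis
      unfolding v g_0 G_def by (simp add: algebra_simps)
  qed
  show ?thesis
    by (rule not_in_l2_spectrum_exp_operator[OF \<theta> G_norm green])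
qed

section \<open>The parametrization \<open>E = w + 1/w\<close> and the spectral alternative\<close>

lemma joukowski_inverse:
  fixes E s :: complex
  assumes "s\<^sup>2 = E\<^sup>2 - 4"
  shows "inverse (E / 2 + s / 2) = E / 2 - s / 2"
proof (rule inverse_unique)
  have "(E / 2 + s / 2) * (E / 2 - s / 2) = (E\<^sup>2 - s\<^sup>2) / 4"
    by (simp add: field_simps power2_eq_square)
  then show "(E / 2 + s / 2) * (E / 2 - s / 2) = 1"
    by (simp add: assms)
qed

text \<open>The candidates for the two signs of the root multiply to 1, so one of them has modulus
  at least 1.\<close>

lemma joukowski_root_exists:
  obtains s :: complex where "s\<^sup>2 = E\<^sup>2 - 4" "cmod (E / 2 + s / 2) \<ge> 1"
proof -
  define r where "r = csqrt (E\<^sup>2 - 4)"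
  have r: "r\<^sup>2 = E\<^sup>2 - 4" "(- r)\<^sup>2 = E\<^sup>2 - 4"
    by (simp_all add: r_def)
  show ?thesis
  proof (cases "cmod (E / 2 + r / 2) \<ge> 1")
    case True
    then show ?thesis
      using that r by blast
  next
    case False
    have "(E / 2 + r / 2) * (E / 2 - r / 2) = 1"
      using r by (simp add: field_simps power2_eq_square)
    then have "cmod (E / 2 + r / 2) * cmod (E / 2 - r / 2) = 1"
      by (metis norm_mult norm_one)
    moreover have "cmod (E / 2 + r / 2) * cmod (E / 2 - r / 2) \<le> 1 * cmod (E / 2 - r / 2)"
      using False by (intro mult_right_mono) auto
    ultimately have "cmod (E / 2 + (- r) / 2) \<ge> 1"
      by simp
    then show ?thesis
      using that r(2) by blast
  qed
qed

text \<open>Convergence is asserted as well, since \<open>lim\<close> is informative only for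
  convergent sequences. The branch of the square root is encoded by letting \<open>s\<close> range
  over all roots meeting the modulus condition; if both do, both moduli are 1 and the value is the
  same.\<close>

theorem theorem1p3:
  fixes \<alpha> lam :: real
  assumes "\<alpha> / (2 * pi) \<notin> \<rat>" and "lam \<noteq> 0"
  shows "(\<forall>E. convergent (lyapunov_mean lam \<alpha> E)) \<and>
    (\<forall>x. \<forall>E \<in> l2_spectrum (exp_operator lam \<alpha> x).
       lyapunov_exponent lam \<alpha> E = max 0 (ln \<bar>lam\<bar>)) \<and>
    (\<forall>E s :: complex. s\<^sup>2 = E\<^sup>2 - 4 \<and> cmod (E / 2 + s / 2) \<ge> 1 \<longrightarrow>
       lyapunov_exponent lam \<alpha> E = max (ln (cmod (E / 2 + s / 2))) (ln \<bar>lam\<bar>))"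
proof (intro conjI allI ballI impI)
  have E_eq: "E = (E / 2 + s / 2) + inverse (E / 2 + s / 2)" if "s\<^sup>2 = E\<^sup>2 - 4" for E s :: complex
    by (simp add: joukowski_inverse[OF that])
  have tendsto: "lyapunov_mean lam \<alpha> E \<longlonglongrightarrow> max (ln (cmod (E / 2 + s / 2))) (ln \<bar>lam\<bar>)"
    if "s\<^sup>2 = E\<^sup>2 - 4" "cmod (E / 2 + s / 2) \<ge> 1" for E s :: complex
    by (rule lyapunov_mean_tendsto[OF assms that(2) E_eq[OF that(1)]])
  show "convergent (lyapunov_mean lam \<alpha> E)" for E
    using joukowski_root_exists[of E] tendsto convergentI by metis
  have formula: "lyapunov_exponent lam \<alpha> E = max (ln (cmod (E / 2 + s / 2))) (ln \<bar>lam\<bar>)"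
    if "s\<^sup>2 = E\<^sup>2 - 4 \<and> cmod (E / 2 + s / 2) \<ge> 1" for E s :: complex
    unfolding lyapunov_exponent_def using that by (intro limI tendsto) auto
  then show "lyapunov_exponent lam \<alpha> E = max (ln (cmod (E / 2 + s / 2))) (ln \<bar>lam\<bar>)"
    if "s\<^sup>2 = E\<^sup>2 - 4 \<and> cmod (E / 2 + s / 2) \<ge> 1" for E s :: complex
    using that by blast
  fix x E assume spec: "E \<in> l2_spectrum (exp_operator lam \<alpha> x)"
  obtain s where s: "s\<^sup>2 = E\<^sup>2 - 4" "cmod (E / 2 + s / 2) \<ge> 1"
    by (rule joukowski_root_exists)
  define w where "w = E / 2 + s / 2"
  have w: "cmod w \<ge> 1" "E = w + inverse w"
    using s E_eq[OF s(1)] by (simp_all add: w_def)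
  \<comment> \<open>Contraposition of \<open>exp_operator_resolvent_point\<close>: on the spectrum
    \<open>cmod w\<close> cannot exceed both 1 and \<open>\<bar>lam\<bar>\<close>.\<close>
  have "cmod w = 1 \<or> cmod w \<le> \<bar>lam\<bar>"
    using exp_operator_resolvent_point[OF assms _ _ w(2), of x] spec w(1) by fastforce
  then have "max (ln (cmod w)) (ln \<bar>lam\<bar>) = max 0 (ln \<bar>lam\<bar>)"
  proof
    assume "cmod w \<le> \<bar>lam\<bar>"
    moreover have "0 \<le> ln (cmod w)"
      using w(1) by simp
    moreover have "ln (cmod w) \<le> ln \<bar>lam\<bar>"
      using w(1) \<open>cmod w \<le> \<bar>lam\<bar>\<close> by (intro ln_mono) auto
    ultimately show ?thesis
      by simp
  qed simp
  then show "lyapunov_exponent lam \<alpha> E = max 0 (ln \<bar>lam\<bar>)"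
    using formula[of s E] s by (simp add: w_def)
qed

end
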